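(* Let $q=p^k$ be a prime power and $t\geq 2$ an integer. (i) If $q$ is odd, then for every $C\in\mathbb{F}_{q^{t-1}}^*$, every $i\in\{1,\dots,k(t-1)\}$ and every sign $\pm$, the map $(X,x)\mapsto(C^2X^{p^i},\pm N(C)x^{p^i})$ is an automorphism of $\mathrm{NG}(q,t)$. (ii) If $q=2^k$, then for every $C\in\mathbb{F}_{q^{t-1}}^*$, $A\in\mathbb{F}_{q^{t-1}}$ and $i\in\{1,\dots,k(t-1)\}$, the map $(X,x)\mapsto(C^2X^{p^i}+A,N(C)x^{p^i})$ is an automorphism of $\mathrm{NG}(q,t)$. (iii) If $q>2$, then the maps in (i) (for $q$ odd), respectively (ii) (for $q$ even), are all the automorphisms of $\mathrm{NG}(q,t)$, and $\mathrm{Aut}(\mathrm{NG}(q,t))\cong Z_{q^{t-1}-1}\rtimes Z_{k(t-1)}$ if $q$ and $t-1$ are both odd; $\mathrm{Aut}(\mathrm{NG}(q,t))\cong (Z_2\times Z_{(q^{t-1}-1)/2})\rtimes Z_{k(t-1)}$ if $q$ is odd and $t-1$ is even; $\mathrm{Aut}(\mathrm{NG}(q,t))\cong ((Z_p)^{k(t-1)}\rtimes Z_{q^{t-1}-1})\rtimes Z_{k(t-1)}$ if $q$ is even.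
   Context: $N:\mathbb{F}_{q^{t-1}}\to\mathbb{F}_q$ is the norm $N(A)=A^{1+q+\cdots+q^{t-2}}$. The projective norm graph $\mathrm{NG}(q,t)$ has vertex set $\mathbb{F}_{q^{t-1}}\times\mathbb{F}_q^*$, with $(A,a)$ and $(B,b)$ adjacent iff $N(A+B)=ab$ (loops allowed, i.e. $(A,a)$ is adjacent to itself iff $N(2A)=a^2$). An automorphism is a permutation of the vertex set preserving this adjacency relation in both directions. $Z_n$ denotes the cyclic group of order $n$, and $\rtimes$ the semidirect product. *)

theory Defs
  imports
    "HOL-Algebra.Bij"
    "HOL-Algebra.Elementary_Groups"
    "HOL-Algebra.Product_Groups"
    "HOL-Algebra.Algebraic_Closure_Type"
begin

(* Graphs are given by a vertex set V and an adjacency relation E; loops are allowed.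
   As in HOL-Algebra.Bij, permutations of V are extensional functions, so that two
   automorphisms are equal iff they agree on V. *)

definition graph_automorphisms :: "'v set \<Rightarrow> ('v \<Rightarrow> 'v \<Rightarrow> bool) \<Rightarrow> ('v \<Rightarrow> 'v) set" where
  "graph_automorphisms V E = {f \<in> Bij V. \<forall>u\<in>V. \<forall>v\<in>V. E u v \<longleftrightarrow> E (f u) (f v)}"

definition graph_Aut :: "'v set \<Rightarrow> ('v \<Rightarrow> 'v \<Rightarrow> bool) \<Rightarrow> ('v \<Rightarrow> 'v) monoid" where
  "graph_Aut V E = BijGroup V \<lparr>carrier := graph_automorphisms V E\<rparr>"

definition field_norm :: "nat \<Rightarrow> nat \<Rightarrow> 'a::field \<Rightarrow> 'a" where
  "field_norm q t A = A ^ (\<Sum>j = 0..t - 2. q ^ j)"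

(* In the next two definitions the type 'a plays the role of the field with q^(t-1) elements
   and K that of its subfield with q elements. *)

definition NG_verts :: "'a::field set \<Rightarrow> ('a \<times> 'a) set" where
  "NG_verts K = UNIV \<times> (K - {0})"

definition NG_adj :: "nat \<Rightarrow> nat \<Rightarrow> 'a::field \<times> 'a \<Rightarrow> 'a \<times> 'a \<Rightarrow> bool" where
  "NG_adj q t = (\<lambda>(A, a) (B, b). field_norm q t (A + B) = a * b)"

(* External semidirect product of N by H, where H acts on N by automorphisms via \<phi>. *)

definition semidirect_product ::
    "('n, 'x) monoid_scheme \<Rightarrow> ('h, 'y) monoid_scheme \<Rightarrow> ('h \<Rightarrow> 'n \<Rightarrow> 'n) \<Rightarrow> ('n \<times> 'h) monoid" where
  "semidirect_product N H \<phi> =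
    \<lparr>carrier = carrier N \<times> carrier H,
     monoid.mult = (\<lambda>(n, h) (n', h'). (n \<otimes>\<^bsub>N\<^esub> \<phi> h n', h \<otimes>\<^bsub>H\<^esub> h')),
     one = (\<one>\<^bsub>N\<^esub>, \<one>\<^bsub>H\<^esub>)\<rparr>"

(* s stands for the sign 1 or -1. *)
definition NG_map_odd ::
    "nat \<Rightarrow> nat \<Rightarrow> nat \<Rightarrow> 'a::field set \<Rightarrow> 'a \<Rightarrow> nat \<Rightarrow> 'a \<Rightarrow> ('a \<times> 'a \<Rightarrow> 'a \<times> 'a)" where
  "NG_map_odd p q t K C i s =
    restrict (\<lambda>(Y, y). (C ^ 2 * Y ^ (p ^ i), s * field_norm q t C * y ^ (p ^ i))) (NG_verts K)"

definition NG_map_even ::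
    "nat \<Rightarrow> nat \<Rightarrow> nat \<Rightarrow> 'a::field set \<Rightarrow> 'a \<Rightarrow> 'a \<Rightarrow> nat \<Rightarrow> ('a \<times> 'a \<Rightarrow> 'a \<times> 'a)" where
  "NG_map_even p q t K C A i =
    restrict (\<lambda>(Y, y). (C ^ 2 * Y ^ (p ^ i) + A, field_norm q t C * y ^ (p ^ i))) (NG_verts K)"

end

(* Common neighbour counts show that an automorphism acts separately on the two coordinates, as
   (Y, y) |-> (F Y, G y), and adjacency then forces G y = c y^e and
   N (F Y - F Z) = c^2 N (Y - Z)^e. It remains to see that F is an affine Frobenius power.
   Write N x = x^n with n = 1 + q + ... + q^(t-2), and normalise F to h with h 0 = 0, h 1 = 1 and
   (h Y - h Z)^n = (Y - Z)^(n e). Since power sums over a finite field mostly vanish, h^T is a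
   combination of the monomials of (Y - Z)^(n e) whenever T is an exponent that occurs in
   (Y - Z)^n. Comparing dimensions, e has only two such exponents, so e is a power of p, and
   composing with a Frobenius power reduces to e = 1. Then h^(q^i) and, for distinct i and j,
   h^(q^i + q^j) have reduced degree at most n, and since q > 2 this leaves some h^(q^j) of
   degree 1. *)
theory Submission
  imports Defs
begin

section \<open>Finite fields\<close>

text \<open>The graph speaks of sums, the algebra of differences. They are linked by
  \<open>F (- A) = - F A\<close>: a nonzero norm of \<open>F A + F (- A)\<close> would make some
  \<open>(- A, y)\<close> adjacent to \<open>(A, 1)\<close>, although \<open>N 0 = 0\<close>. At
  \<open>A = 0\<close> this becomes \<open>F 0 + F 0 = 0\<close>, the constraint on the translation
  part. An isometry of the norm has no additivity to start from; degrees replace it. All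
  base-\<open>q\<close> digits of the norm exponent are 1, so Lucas' theorem provides the exponents
  used. For \<open>q > 2\<close> twice the norm exponent is below the field size, so a product of
  two reduced polynomials is still reduced. For \<open>q = 2\<close> every nonzero element has norm
  1 and every permutation would be an isometry. The parameter \<open>C\<close> need not be
  determined by its map. The group is therefore computed with \<open>D\<close> and \<open>c\<close>,
  subject to \<open>c ^ 2 = N D\<close>, in place of \<open>C ^ 2\<close> and the signed norm. The
  three groups correspond to \<open>-1 = 1\<close>, to \<open>-1\<close> of norm \<open>-1\<close>,
  and to \<open>-1\<close> different from 1 but of norm 1.\<close>

lemma nonzero_power_card_minus_1:
  fixes x :: "'a::{field,finite}"
  assumes "x \<noteq> 0"
  shows "x ^ (card (UNIV :: 'a set) - 1) = 1"
proof -
  have "(\<Prod>y\<in>UNIV-{0}. x * y) = x ^ (card (UNIV :: 'a set) - 1) * \<Prod>(UNIV-{0})"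
    by (simp add: prod.distrib)
  moreover have "(\<Prod>y\<in>UNIV-{0}. x * y) = \<Prod>(UNIV-{0})"
    by (rule prod.reindex_bij_witness[of _ "\<lambda>y. y / x" "\<lambda>y. x * y"]) (use assms in auto)
  ultimately show ?thesis
    by simp
qed

lemma card_UNIV_ge_2: "card (UNIV :: 'a::{field,finite} set) \<ge> 2"
proof -
  have "card {0, 1 :: 'a} \<le> card (UNIV :: 'a set)"
    by (intro card_mono) auto
  thus ?thesis by simp
qed

lemma power_card_UNIV:
  fixes x :: "'a::{field,finite}"
  shows "x ^ card (UNIV :: 'a set) = x"
proof (cases "x = 0")
  case False
  have "x ^ card (UNIV :: 'a set) = x * x ^ (card (UNIV :: 'a set) - 1)"
    using card_UNIV_ge_2[where ?'a = 'a] by (simp flip: power_Suc)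
  with False show ?thesis
    by (simp add: nonzero_power_card_minus_1 del: One_nat_def)
qed (use card_UNIV_ge_2[where ?'a = 'a] in auto)

lemma power_mod_eq:
  fixes x :: "'b::monoid_mult"
  assumes "x ^ h = 1"
  shows "x ^ (i mod h) = x ^ i"
proof -
  have "x ^ i = x ^ (h * (i div h) + i mod h)" by simp
  also have "\<dots> = x ^ (i mod h)" by (simp only: power_add power_mult assms power_one mult_1_left)
  finally show ?thesis ..
qed

text \<open>Cyclicity comes from HOL-Algebra through \<open>ring_of_type_algebra\<close>. The order
  of \<open>w\<close> follows by counting: reduced exponents reach all nonzero elements, hence do so
  injectively.\<close>

lemma finite_field_generator:
  obtains w :: "'a::{field,finite}"
  where "w \<noteq> 0" and "\<And>x. x \<noteq> 0 \<Longrightarrow> \<exists>i < card (UNIV :: 'a set) - 1. x = w ^ i"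
    and "\<And>i. w ^ i = 1 \<longleftrightarrow> (card (UNIV :: 'a set) - 1) dvd i"
proof -
  let ?R = "ring_of_type_algebra :: 'a ring"
  let ?m = "card (UNIV :: 'a set) - 1"
  have m: "?m > 0" using card_UNIV_ge_2[where ?'a = 'a] by simp
  interpret R: Ring.field ?R by (rule field_from_type_algebra)
  have fin: "finite (carrier ?R)" by simp
  have car: "carrier (Multiplicative_Group.mult_of ?R) = UNIV - {0}"
    by (auto simp: ring_of_type_algebra_def)
  have pw: "x [^]\<^bsub>?R\<^esub> i = x ^ i" for x :: 'a and i :: nat
    by (induction i) (auto simp: ring_of_type_algebra_def Group.nat_pow_def)
  obtain w :: 'a where w: "w \<in> UNIV - {0}" "UNIV - {0} = {w ^ i | i::nat. i \<in> UNIV}"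
    using R.finite_field_mult_group_has_gen[OF fin, unfolded car pw] by (elim bexE)
  have w0: "w \<noteq> 0" using w(1) by simp
  have red: "w ^ i = w ^ (i mod ?m)" for i
    by (rule power_mod_eq[OF nonzero_power_card_minus_1[OF w0], symmetric])
  have ex: "\<exists>i < ?m. x = w ^ i" if "x \<noteq> 0" for x
  proof -
    obtain i where "x = w ^ i" using w(2) \<open>x \<noteq> 0\<close> by blast
    thus ?thesis using red[of i] m by (intro exI[of _ "i mod ?m"]) auto
  qed
  have "(\<lambda>i. w ^ i) ` {..<?m} = UNIV - {0}"
    using ex w0 by (intro equalityI subsetI) (auto simp: image_iff)
  hence inj: "inj_on (\<lambda>i. w ^ i) {..<?m}"
    by (intro eq_card_imp_inj_on) auto
  have "w ^ i = 1 \<longleftrightarrow> ?m dvd i" for i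
  proof
    assume "w ^ i = 1"
    hence "w ^ (i mod ?m) = w ^ 0" using red[of i] by simp
    hence "i mod ?m = 0" using m by (intro inj_onD[OF inj]) auto
    thus "?m dvd i" by auto
  next
    assume "?m dvd i" thus "w ^ i = 1" using red[of i] by (auto elim: dvdE)
  qed
  with w0 ex show ?thesis by (rule that)
qed

lemma of_nat_card_UNIV: "of_nat (card (UNIV :: 'a::{field,finite} set)) = (0 :: 'a)"
proof -
  have "(\<Sum>y\<in>UNIV. y + 1 :: 'a) = (\<Sum>y\<in>UNIV. y)"
    by (rule sum.reindex_bij_witness[of _ "\<lambda>y. y - 1" "\<lambda>y. y + 1"]) auto
  thus ?thesis by (simp add: sum.distrib)
qed

text \<open>Replacing \<open>y\<close> by \<open>w * y\<close> for a generator \<open>w\<close>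
  multiplies the sum by \<open>w ^ m\<close>, so it vanishes unless \<open>w ^ m = 1\<close>; then
  each nonzero element contributes 1, and the field size is 0 in the field. For \<open>m = 0\<close>
  the term \<open>0 ^ 0 = 1\<close> would change the count.\<close>

lemma sum_powers_finite_field:
  fixes m :: nat
  assumes "m > 0"
  shows "(\<Sum>y\<in>(UNIV :: 'a::{field,finite} set). y ^ m) =
           (if (card (UNIV :: 'a set) - 1) dvd m then -1 else 0)"
proof -
  obtain w :: 'a where w: "w \<noteq> 0" "\<And>i. w ^ i = 1 \<longleftrightarrow> (card (UNIV :: 'a set) - 1) dvd i"
    by (rule finite_field_generator) (rule that)
  let ?S = "\<Sum>y\<in>UNIV - {0 :: 'a}. y ^ m"
  have S: "(\<Sum>y\<in>UNIV. y ^ m) = ?S"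
    using assms by (intro sum.mono_neutral_right) auto
  show ?thesis
  proof (cases "(card (UNIV :: 'a set) - 1) dvd m")
    case True
    then obtain j where j: "m = (card (UNIV :: 'a set) - 1) * j" by auto
    have "?S = (\<Sum>y\<in>UNIV - {0 :: 'a}. 1)"
      by (intro sum.cong) (simp_all add: j power_mult nonzero_power_card_minus_1 del: One_nat_def)
    also have "\<dots> = of_nat (card (UNIV :: 'a set)) - 1"
      using card_UNIV_ge_2[where ?'a = 'a] by simp
    also have "\<dots> = -1"
      by (simp add: of_nat_card_UNIV)
    finally show ?thesis using S True by simp
  next
    case False
    have "w ^ m * ?S = (\<Sum>y\<in>UNIV - {0 :: 'a}. (w * y) ^ m)"
      by (simp add: sum_distrib_left power_mult_distrib)
    also have "\<dots> = ?S"
      by (rule sum.reindex_bij_witness[of _ "\<lambda>y. y / w" "\<lambda>y. w * y"]) (use w in auto)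
    finally have "(w ^ m - 1) * ?S = 0" by (simp add: algebra_simps)
    with False w S show ?thesis by simp
  qed
qed

lemma poly_eqI_finite_field:
  fixes P R :: "'a::{field,finite} Polynomial.poly"
  assumes "\<And>x. Polynomial.poly P x = Polynomial.poly R x"
    and "Polynomial.degree P < card (UNIV :: 'a set)" "Polynomial.degree R < card (UNIV :: 'a set)"
  shows "P = R"
  using assms by (intro poly_eqI_degree[of UNIV]) auto

section \<open>Bijections preserving powers of differences\<close>

text \<open>Summing against a power of \<open>y\<close> extracts one coefficient of
  \<open>(x - y) ^ E\<close>. In the term with index \<open>k\<close> the exponent of
  \<open>y\<close> is \<open>m + T - k\<close>, with \<open>m\<close> the number of nonzero
  elements; it lies strictly between 0 and \<open>2 * m\<close>, so it is a multiple of
  \<open>m\<close> only for \<open>k = T\<close>.\<close>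

lemma sum_binomial_expansion:
  fixes x :: "'a::{field,finite}"
  assumes E: "E < card (UNIV :: 'a set) - 1" and "T \<le> E"
  shows "(\<Sum>y\<in>UNIV. y ^ (card (UNIV :: 'a set) - 1 - (E - T)) * (x - y) ^ E) =
           - (of_nat (E choose T) * (-1) ^ (E - T) * x ^ T)"
proof -
  define m where "m = card (UNIV :: 'a set) - 1"
  have assms: "E < m" "T \<le> E" using assms by (simp_all add: m_def)
  have "(\<Sum>y\<in>UNIV. y ^ (m - (E - T)) * (x - y) ^ E) =
        (\<Sum>y\<in>UNIV. \<Sum>k\<le>E. of_nat (E choose k) * (-1) ^ (E - k) * x ^ k * y ^ (m - (E - T) + (E - k)))"
  proof (intro sum.cong refl)
    fix y :: 'a
    have "(x - y) ^ E = (\<Sum>k\<le>E. of_nat (E choose k) * x ^ k * (- y) ^ (E - k))"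
      using binomial_ring[of x "- y" E] by simp
    also have "\<dots> = (\<Sum>k\<le>E. of_nat (E choose k) * x ^ k * ((-1) ^ (E - k) * y ^ (E - k)))"
      by (intro sum.cong refl) (simp only: power_minus[of y])
    finally show "y ^ (m - (E - T)) * (x - y) ^ E =
        (\<Sum>k\<le>E. of_nat (E choose k) * (-1) ^ (E - k) * x ^ k * y ^ (m - (E - T) + (E - k)))"
      by (simp only: sum_distrib_left power_add mult_ac)
  qed
  also have "\<dots> = (\<Sum>k\<le>E. of_nat (E choose k) * (-1) ^ (E - k) * x ^ k *
                     (\<Sum>y\<in>UNIV. y ^ (m - (E - T) + (E - k))))"
    by (subst sum.swap) (simp only: sum_distrib_left)
  also have "\<dots> = (\<Sum>k\<le>E. if k = T then - (of_nat (E choose k) * (-1) ^ (E - k) * x ^ k) else 0)"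
  proof (intro sum.cong refl)
    fix k assume "k \<in> {..E}"
    hence k: "k \<le> E" by simp
    have "m dvd m - (E - T) + (E - k) \<longleftrightarrow> k = T"
    proof
      assume "m dvd m - (E - T) + (E - k)"
      then obtain c where c: "m - (E - T) + (E - k) = m * c" by (elim dvdE)
      have "0 < m - (E - T) + (E - k)" "m - (E - T) + (E - k) < m * 2"
        using k assms by linarith+
      hence "c = 1" unfolding c by simp
      thus "k = T" using c k assms by simp
    next
      assume "k = T" thus "m dvd m - (E - T) + (E - k)" using assms by simp
    qed
    moreover have "m - (E - T) + (E - k) > 0" using assms by linarith
    ultimately show "of_nat (E choose k) * (-1) ^ (E - k) * x ^ k * (\<Sum>y\<in>UNIV. y ^ (m - (E - T) + (E - k)))
        = (if k = T then - (of_nat (E choose k) * (-1) ^ (E - k) * x ^ k) else 0)"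
      by (simp add: sum_powers_finite_field m_def[symmetric] del: One_nat_def)
  qed
  also have "\<dots> = - (of_nat (E choose T) * (-1) ^ (E - T) * x ^ T)"
    using assms by simp
  finally show ?thesis unfolding m_def .
qed

text \<open>In characteristic \<open>p\<close> these are the exponents of \<open>x\<close> that
  survive in the expansion of \<open>(x - y) ^ E\<close>.\<close>

definition binomial_support :: "nat \<Rightarrow> nat \<Rightarrow> nat set" where
  "binomial_support p E = {T. \<not> p dvd (E choose T)}"

lemma binomial_support_subset: "binomial_support p E \<subseteq> {..E}"
proof
  fix T assume "T \<in> binomial_support p E"
  hence "E choose T \<noteq> 0" unfolding binomial_support_def by (metis dvd_0_right mem_Collect_eq)
  thus "T \<in> {..E}" using binomial_eq_0[of E T] by (meson atMost_iff not_less)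
qed

lemma finite_binomial_support: "finite (binomial_support p E)"
  by (rule finite_subset[OF binomial_support_subset]) simp

lemma binomial_support_iff:
  "T \<in> binomial_support CHAR('a::{field,finite}) E \<longleftrightarrow> of_nat (E choose T) \<noteq> (0 :: 'a)"
  by (simp add: binomial_support_def of_nat_eq_0_iff_char_dvd)

text \<open>Since \<open>h\<close> is a bijection, the sum that extracts \<open>h x ^ T\<close> from
  \<open>(h x - z) ^ E1\<close> may run over \<open>z = h y\<close>. There the hypothesis replaces
  the power by \<open>(x - y) ^ E2\<close>, and only its exponents of \<open>x\<close>
  remain.\<close>

lemma power_in_span_of_difference_powers:
  fixes h :: "'a::{field,finite} \<Rightarrow> 'a"
  assumes "bij h" and eq: "\<And>x y. (h x - h y) ^ E1 = (x - y) ^ E2"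
    and E1: "E1 < card (UNIV :: 'a set) - 1" and T: "T \<in> binomial_support CHAR('a) E1"
  shows "\<exists>c. \<forall>x. h x ^ T = (\<Sum>m\<in>binomial_support CHAR('a) E2. c m * x ^ m)"
proof -
  let ?m = "card (UNIV :: 'a set) - 1"
  define N where "N = ?m - (E1 - T)"
  define b :: 'a where "b = - (of_nat (E1 choose T) * (-1) ^ (E1 - T))"
  define c where "c m = (\<Sum>y\<in>UNIV. h y ^ N * of_nat (E2 choose m) * (- y) ^ (E2 - m))" for m
  have b: "b \<noteq> 0" using T by (simp add: b_def binomial_support_iff)
  have TE: "T \<le> E1" using T binomial_support_subset by blast
  have "b * h x ^ T = (\<Sum>m\<in>binomial_support CHAR('a) E2. c m * x ^ m)" for x
  proof -
    have "b * h x ^ T = (\<Sum>z\<in>UNIV. z ^ N * (h x - z) ^ E1)"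
      unfolding N_def sum_binomial_expansion[OF E1 TE] b_def by simp
    also have "\<dots> = (\<Sum>y\<in>UNIV. h y ^ N * (h x - h y) ^ E1)"
      using sum.reindex_bij_betw[OF \<open>bij h\<close>, of "\<lambda>z. z ^ N * (h x - z) ^ E1"] by simp
    also have "\<dots> = (\<Sum>y\<in>UNIV. \<Sum>m\<le>E2. h y ^ N * of_nat (E2 choose m) * (- y) ^ (E2 - m) * x ^ m)"
    proof (intro sum.cong refl)
      fix y
      show "h y ^ N * (h x - h y) ^ E1 =
            (\<Sum>m\<le>E2. h y ^ N * of_nat (E2 choose m) * (- y) ^ (E2 - m) * x ^ m)"
        unfolding eq using binomial_ring[of x "- y" E2] by (simp add: sum_distrib_left mult_ac)
    qed
    also have "\<dots> = (\<Sum>m\<le>E2. c m * x ^ m)"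
      by (subst sum.swap) (simp only: sum_distrib_right c_def)
    also have "\<dots> = (\<Sum>m\<in>binomial_support CHAR('a) E2. c m * x ^ m)"
      by (intro sum.mono_neutral_right binomial_support_subset)
         (auto simp: binomial_support_iff c_def)
    finally show ?thesis .
  qed
  hence "\<forall>x. h x ^ T = (\<Sum>m\<in>binomial_support CHAR('a) E2. (c m / b) * x ^ m)"
    using b by (simp add: field_simps sum_divide_distrib[symmetric])
  thus ?thesis by (rule exI[where x = "\<lambda>m. c m / b"])
qed

text \<open>Both sides count functions: composing with \<open>h\<close> embeds the span of the monomials
  in the left support into the span of those in the right support.\<close>
lemma card_binomial_support_le:
  fixes h :: "'a::{field,finite} \<Rightarrow> 'a"
  assumes "bij h" and eq: "\<And>x y. (h x - h y) ^ E1 = (x - y) ^ E2"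
    and E1: "E1 < card (UNIV :: 'a set) - 1"
  shows "card (binomial_support CHAR('a) E1) \<le> card (binomial_support CHAR('a) E2)"
proof -
  let ?S1 = "binomial_support CHAR('a) E1" and ?S2 = "binomial_support CHAR('a) E2"
  let ?F = "\<lambda>S (u :: nat \<Rightarrow> 'a) x. \<Sum>m\<in>S. u m * x ^ m"
  let ?W = "\<lambda>S. PiE S (\<lambda>_. UNIV :: 'a set)"
  have fin: "finite ?S1" "finite ?S2" by (rule finite_binomial_support)+
  have inj: "inj_on (?F ?S1) (?W ?S1)"
  proof (rule inj_onI)
    fix u v :: "nat \<Rightarrow> 'a" assume uv: "u \<in> ?W ?S1" "v \<in> ?W ?S1" "?F ?S1 u = ?F ?S1 v"
    define P where "P u = (\<Sum>m\<in>?S1. Polynomial.monom (u m) m)" for u :: "nat \<Rightarrow> 'a"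
    \<comment> \<open>Exponents up to \<open>E1\<close> stay below the field size, so the monomials
      are independent as functions and not merely as polynomials.\<close>
    have deg: "Polynomial.degree (P u) < card (UNIV :: 'a set)" for u
    proof -
      have "Polynomial.degree (P u) \<le> E1" unfolding P_def
        using fin binomial_support_subset[of "CHAR('a)" E1]
        by (intro degree_sum_le) (auto intro: order_trans[OF degree_monom_le])
      thus ?thesis using E1 by linarith
    qed
    have "P u = P v"
    proof (rule poly_eqI_finite_field[OF _ deg deg])
      fix x show "Polynomial.poly (P u) x = Polynomial.poly (P v) x"
        using fun_cong[OF uv(3), of x] by (simp add: P_def poly_sum poly_monom)
    qed
    moreover have "Polynomial.coeff (P u) m = u m" if "m \<in> ?S1" for u m
      using that fin by (simp add: P_def coeff_sum)
    ultimately show "u = v" using uv(1,2) by (metis PiE_ext)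
  qed
  have sub: "(\<lambda>\<phi>. \<phi> \<circ> h) ` ?F ?S1 ` ?W ?S1 \<subseteq> ?F ?S2 ` ?W ?S2"
  proof (intro subsetI)
    fix \<phi> assume "\<phi> \<in> (\<lambda>\<phi>. \<phi> \<circ> h) ` ?F ?S1 ` ?W ?S1"
    then obtain u where u: "\<phi> = ?F ?S1 u \<circ> h" by blast
    have "\<forall>T\<in>?S1. \<exists>c. \<forall>x. h x ^ T = (\<Sum>m\<in>?S2. c m * x ^ m)"
      using power_in_span_of_difference_powers[OF \<open>bij h\<close> eq E1] by blast
    then obtain c where c: "\<And>T x. T \<in> ?S1 \<Longrightarrow> h x ^ T = (\<Sum>m\<in>?S2. c T m * x ^ m)"
      by metis
    define v where "v = restrict (\<lambda>m. \<Sum>T\<in>?S1. u T * c T m) ?S2"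
    have "\<phi> x = ?F ?S2 v x" for x
    proof -
      have "\<phi> x = (\<Sum>T\<in>?S1. \<Sum>m\<in>?S2. u T * c T m * x ^ m)"
        unfolding u by (simp add: c sum_distrib_left mult.assoc)
      also have "\<dots> = ?F ?S2 v x"
        by (subst sum.swap) (simp add: sum_distrib_right v_def)
      finally show ?thesis .
    qed
    moreover have "v \<in> ?W ?S2" by (simp add: v_def)
    ultimately show "\<phi> \<in> ?F ?S2 ` ?W ?S2" by blast
  qed
  have comp_inj: "inj (\<lambda>\<phi> :: 'a \<Rightarrow> 'a. \<phi> \<circ> h)"
    using \<open>bij h\<close> by (metis bij_is_surj injI surj_fun_eq)
  have finW: "finite (?W ?S2)" using fin by (intro finite_PiE) auto
  let ?Q = "card (UNIV :: 'a set)"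
  have "?Q ^ card ?S1 = card (?W ?S1)"
    using fin by (simp add: card_PiE)
  also have "\<dots> = card ((\<lambda>\<phi>. \<phi> \<circ> h) ` ?F ?S1 ` ?W ?S1)"
    using card_image[OF inj] card_image[OF inj_on_subset[OF comp_inj subset_UNIV]] by metis
  also have "\<dots> \<le> card (?W ?S2)"
    using card_mono[OF finite_imageI[OF finW] sub] card_image_le[OF finW] by (rule order_trans)
  also have "\<dots> = ?Q ^ card ?S2"
    using fin by (simp add: card_PiE)
  finally show ?thesis
    using card_UNIV_ge_2[where ?'a = 'a] by (subst (asm) power_increasing_iff) auto
qed

section \<open>Binomial coefficients modulo the characteristic\<close>

lemma of_nat_choose_prime_power_eq_0:
  assumes "Factorial_Ring.prime CHAR('a::field)" and "0 < k" "k < CHAR('a) ^ r"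
  shows "of_nat (CHAR('a) ^ r choose k) = (0 :: 'a)"
proof -
  let ?M = "CHAR('a) ^ r"
  \<comment> \<open>The coefficient is read off \<open>(1 + X) ^ ?M\<close>, which the freshman's
    dream collapses to \<open>1 + X ^ ?M\<close>.\<close>
  have "of_nat (?M choose k) = Polynomial.coeff ([:1, 1:] ^ ?M) k"
    using assms by (subst coeff_linear_poly_power) simp_all
  also have "[:1, 1:] = 1 + Polynomial.monom (1 :: 'a) 1"
    by (simp add: monom_altdef one_pCons)
  also have "\<dots> ^ ?M = 1 ^ ?M + Polynomial.monom 1 1 ^ ?M"
    using assms(1) by (intro freshmans_dream') auto
  also have "Polynomial.coeff \<dots> k = 0"
    using assms by (simp add: monom_power)
  finally show ?thesis .
qed

text \<open>Lucas' theorem, splitting off the low part below the power \<open>M\<close> of the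
  characteristic. Raising \<open>b\<close> by one adds \<open>M\<close> to the upper entry; in the
  corresponding Vandermonde sum only the indices 0 and \<open>M\<close> can survive, and they
  produce the two terms of Pascal's rule for \<open>b\<close> and \<open>d\<close>.\<close>

lemma of_nat_choose_Lucas:
  assumes p: "Factorial_Ring.prime CHAR('a::field)" and M: "M = CHAR('a) ^ r" and "a < M" "c < M"
  shows "of_nat ((a + M * b) choose (c + M * d)) = (of_nat (a choose c) * of_nat (b choose d) :: 'a)"
proof (induction b arbitrary: d)
  case 0
  show ?case
  proof (cases d)
    case (Suc d')
    hence "a < c + M * d" using \<open>a < M\<close> by simp
    hence "a choose (c + M * d) = 0" by (rule binomial_eq_0)
    thus ?thesis using Suc by (simp del: binomial_eq_0_iff)
  qed simp
next
  case (Suc b)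
  let ?n = "a + M * b" and ?k = "c + M * d"
  let ?t = "\<lambda>i. of_nat (M choose i) * of_nat (?n choose (?k - i)) :: 'a"
  have M0: "M > 0" using assms by linarith
  have "of_nat ((a + M * Suc b) choose ?k) = (of_nat ((M + ?n) choose ?k) :: 'a)"
    by (simp add: algebra_simps)
  also have "\<dots> = (\<Sum>i\<le>?k. ?t i)"
    by (simp flip: vandermonde)
  also have "\<dots> = (\<Sum>i\<in>{0, M} \<inter> {..?k}. ?t i)"
  proof (intro sum.mono_neutral_right ballI)
    fix i assume i: "i \<in> {..?k} - {0, M} \<inter> {..?k}"
    show "?t i = 0"
    proof (cases "i < M")
      case True
      thus ?thesis using of_nat_choose_prime_power_eq_0[OF p, of i r] i M by auto
    next
      case False
      with i have "M < i" by (cases "i = M") auto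
      hence "M choose i = 0" by (rule binomial_eq_0)
      thus ?thesis by (simp del: binomial_eq_0_iff)
    qed
  qed auto
  also have "\<dots> = of_nat (a choose c) * of_nat (Suc b choose d)"
  proof (cases d)
    case 0
    hence "{0, M} \<inter> {..?k} = {0}" using \<open>c < M\<close> by auto
    hence "(\<Sum>i\<in>{0, M} \<inter> {..?k}. ?t i) = (\<Sum>i\<in>{0}. ?t i)" by (rule arg_cong)
    thus ?thesis using Suc.IH[of 0] 0 by simp
  next
    case (Suc d')
    hence "{0, M} \<inter> {..?k} = {0, M}" by auto
    hence "(\<Sum>i\<in>{0, M} \<inter> {..?k}. ?t i) = (\<Sum>i\<in>{0, M}. ?t i)" by (rule arg_cong)
    moreover have "?k - M = c + M * d'" using Suc by simp
    ultimately show ?thesis using Suc.IH[of d] Suc.IH[of d'] M0 Suc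
      by (simp add: algebra_simps)
  qed
  finally show ?case .
qed

lemma card_binomial_support_split:
  assumes p: "Factorial_Ring.prime CHAR('a::{field,finite})" and M: "M = CHAR('a) ^ r" and "a < M"
  shows "card (binomial_support CHAR('a) (a + M * b)) =
           card (binomial_support CHAR('a) a) * card (binomial_support CHAR('a) b)"
proof -
  let ?D = "binomial_support CHAR('a)"
  have iff: "c + M * d \<in> ?D (a + M * b) \<longleftrightarrow> c \<in> ?D a \<and> d \<in> ?D b" if "c < M" for c d
    unfolding binomial_support_iff[where ?'a = 'a]
    by (simp add: of_nat_choose_Lucas[OF p M \<open>a < M\<close> that])
  have lt: "c < M" if "c \<in> ?D a" for c
    using that binomial_support_subset[of "CHAR('a)" a] \<open>a < M\<close> by fastforce
  have "bij_betw (\<lambda>(c, d). c + M * d) (?D a \<times> ?D b) (?D (a + M * b))"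
  proof (rule bij_betw_byWitness[where f' = "\<lambda>T. (T mod M, T div M)"])
    show "\<forall>T\<in>?D (a + M * b). (\<lambda>(c, d). c + M * d) (T mod M, T div M) = T"
      by simp
    show "(\<lambda>T. (T mod M, T div M)) ` ?D (a + M * b) \<subseteq> ?D a \<times> ?D b"
    proof (intro image_subsetI)
      fix T assume "T \<in> ?D (a + M * b)"
      hence "T mod M + M * (T div M) \<in> ?D (a + M * b)" by simp
      thus "(T mod M, T div M) \<in> ?D a \<times> ?D b"
        using \<open>a < M\<close> by (subst (asm) iff) auto
    qed
  qed (use lt iff \<open>a < M\<close> in \<open>auto simp: div_add1_eq\<close>)
  thus ?thesis by (metis bij_betw_same_card card_cartesian_product)
qed

lemma geometric_sum_mult: "(q - 1) * (\<Sum>j<n. q ^ j) + 1 = (q::nat) ^ n" if "q > 0"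
proof (induction n)
  case (Suc n)
  have "(q - 1) * (\<Sum>j<Suc n. q ^ j) + 1 = ((q - 1) * (\<Sum>j<n. q ^ j) + 1) + (q - 1) * q ^ n"
    by (simp add: algebra_simps)
  also have "\<dots> = q ^ n + (q - 1) * q ^ n" by (simp only: Suc)
  also have "\<dots> = q ^ Suc n" using that by (cases q) auto
  finally show ?case .
qed simp

lemma geometric_sum_less: "(\<Sum>j<n. q ^ j) * e < (q::nat) ^ n" if "e < q"
proof -
  have "(\<Sum>j<n. q ^ j) * e \<le> (q - 1) * (\<Sum>j<n. q ^ j)"
    using that by (subst mult.commute) (intro mult_right_mono, auto)
  thus ?thesis using geometric_sum_mult[of q n] that by linarith
qed

text \<open>For \<open>e < q\<close> there are no carries: all \<open>n\<close>
  base-\<open>q\<close> digits of the product equal \<open>e\<close>, and each contributes the same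
  factor.\<close>

lemma card_binomial_support_geometric:
  assumes p: "Factorial_Ring.prime CHAR('a::{field,finite})" and q: "q = CHAR('a) ^ k" and "e < q"
  shows "card (binomial_support CHAR('a) ((\<Sum>j<n. q ^ j) * e)) =
           card (binomial_support CHAR('a) e) ^ n"
proof (induction n)
  case 0
  have "binomial_support CHAR('a) 0 = {0}"
    using binomial_support_subset[of "CHAR('a)" 0] p
    by (auto simp: binomial_support_def)
  thus ?case by simp
next
  case (Suc n)
  have "(\<Sum>j<Suc n. q ^ j) * e = (\<Sum>j<n. q ^ j) * e + q ^ n * e"
    by (simp add: algebra_simps)
  moreover have "q ^ n = CHAR('a) ^ (k * n)" by (simp add: q power_mult)
  ultimately show ?case
    using card_binomial_support_split[OF p _ geometric_sum_less[OF \<open>e < q\<close>]] Suc by simp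
qed

text \<open>All base-\<open>q\<close> digits of the sum are 1 and those of the lower entry are 0 or
  1, so Lucas gives a product of ones. These are the exponents for which the degree argument needs a
  nonzero coefficient.\<close>

lemma of_nat_geometric_sum_choose:
  assumes p: "Factorial_Ring.prime CHAR('a::field)" and q: "q = CHAR('a) ^ k" and k: "k \<ge> 1"
  shows "i < n \<Longrightarrow> of_nat ((\<Sum>j<n. q ^ j) choose (q ^ i)) = (1 :: 'a)"
    and "i < j \<Longrightarrow> j < n \<Longrightarrow> of_nat ((\<Sum>j<n. q ^ j) choose (q ^ i + q ^ j)) = (1 :: 'a)"
proof (induction n)
  case (Suc n)
  let ?N = "\<Sum>j<n. q ^ j"
  have q2: "q \<ge> 2"
    using p k prime_ge_2_nat[OF p] self_le_power[of "CHAR('a)" k] unfolding q by linarith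
  have qn: "q ^ n = CHAR('a) ^ (k * n)" by (simp add: q power_mult)
  have lt: "?N < q ^ n" using geometric_sum_less[of 1 q n] q2 by simp
  have rec: "of_nat ((\<Sum>j<Suc n. q ^ j) choose (c + q ^ n * d)) = (of_nat (?N choose c) * of_nat (1 choose d) :: 'a)"
    if "c < q ^ n" for c d
    using of_nat_choose_Lucas[OF p qn lt that, of 1 d] by (simp add: add.commute)
  have mono: "q ^ i < q ^ n" if "i < n" for i using that q2 by simp
  {
    case 1
    show ?case
    proof (cases "i = n")
      case True
      thus ?thesis using rec[of 0 1] q2 by simp
    next
      case False
      thus ?thesis using rec[of "q ^ i" 0] mono 1 Suc.IH(1) by simp
    qed
  next
    case 2
    show ?case
    proof (cases "j = n")
      case True
      thus ?thesis using rec[of "q ^ i" 1] mono 2 Suc.IH(1) by simp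
    next
      case False
      hence "j < n" using 2 by simp
      have "q ^ i + q ^ j < q ^ n"
      proof -
        have "q ^ i < q ^ j" using 2 q2 by simp
        hence "q ^ i + q ^ j < 2 * q ^ j" by simp
        also have "\<dots> \<le> q ^ Suc j" using q2 by simp
        also have "\<dots> \<le> q ^ n" using \<open>j < n\<close> q2 by (intro power_increasing) auto
        finally show ?thesis .
      qed
      thus ?thesis using rec[of "q ^ i + q ^ j" 0] 2 \<open>j < n\<close> Suc.IH(2) by simp
    qed
  }
qed auto

text \<open>Besides 0 and \<open>e\<close>, the support contains the largest power of the
  characteristic dividing \<open>e\<close>: the binomial coefficient there is the cofactor modulo
  the characteristic, which is nonzero. With two elements in all, that power must be
  \<open>e\<close>.\<close>

lemma prime_power_if_card_binomial_support_eq_2: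
  assumes p: "Factorial_Ring.prime CHAR('a::{field,finite})" and "e > 0"
    and card: "card (binomial_support CHAR('a) e) = 2"
  shows "\<exists>i. e = CHAR('a) ^ i"
proof -
  let ?p = "CHAR('a)"
  obtain i m where im: "e = ?p ^ i * m" "\<not> ?p dvd m"
    using multiplicity_decompose'[of e ?p] \<open>e > 0\<close> p
    by (metis not_prime_unit not_gr_zero)
  have "?p ^ i > 0" using p by (simp add: prime_gt_0_nat)
  have "of_nat (e choose ?p ^ i) = (of_nat m :: 'a)"
    using of_nat_choose_Lucas[OF p refl, of 0 i 0 m 1] im \<open>?p ^ i > 0\<close> by simp
  hence "?p ^ i \<in> binomial_support ?p e"
    using im by (simp add: binomial_support_iff of_nat_eq_0_iff_char_dvd)
  moreover have "{0, e} \<subseteq> binomial_support ?p e"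
    using p by (auto simp: binomial_support_def)
  hence "binomial_support ?p e = {0, e}"
    using card \<open>e > 0\<close> by (intro card_subset_eq[symmetric] finite_binomial_support) auto
  ultimately show ?thesis using \<open>?p ^ i > 0\<close> by auto
qed

text \<open>Here \<open>p\<close> may be any number with \<open>p ^ m\<close> equal to the field
  size; the lemma serves for powers of the characteristic and for powers of \<open>q\<close>
  alike.\<close>

lemma Frobenius_power_mod:
  fixes x :: "'a::{field,finite}"
  assumes "card (UNIV :: 'a set) = p ^ m"
  shows "x ^ (p ^ (i mod m)) = x ^ (p ^ i)"
proof -
  have "y ^ (p ^ (m * c)) = y" for y :: 'a and c
  proof (induction c)
    case (Suc c)
    have "y ^ (p ^ (m * Suc c)) = (y ^ (p ^ (m * c))) ^ (p ^ m)"
      by (simp add: power_add mult.commute flip: power_mult)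
    thus ?case using Suc power_card_UNIV[of y] assms by simp
  qed simp
  hence "(x ^ (p ^ (i mod m))) ^ (p ^ (m * (i div m))) = x ^ (p ^ (i mod m))" .
  thus ?thesis
    by (simp flip: power_mult power_add)
qed

section \<open>Degree argument for maps preserving powers of differences\<close>

lemma degree_bound_of_differences:
  fixes h :: "'a::{field,finite} \<Rightarrow> 'a"
  assumes "bij h" and "\<And>x y. (h x - h y) ^ E1 = (x - y) ^ E2"
    and "E1 < card (UNIV :: 'a set) - 1" and "of_nat (E1 choose T) \<noteq> (0 :: 'a)"
  shows "\<exists>P. Polynomial.degree P \<le> E2 \<and> (\<forall>x. Polynomial.poly P x = h x ^ T)"
proof -
  let ?S = "binomial_support CHAR('a) E2"
  obtain c where c: "\<And>x. h x ^ T = (\<Sum>m\<in>?S. c m * x ^ m)"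
    using power_in_span_of_difference_powers[OF assms(1-3), of T] assms(4)
    by (auto simp: binomial_support_iff)
  let ?P = "\<Sum>m\<in>?S. Polynomial.monom (c m) m"
  have "Polynomial.degree ?P \<le> E2"
    using binomial_support_subset[of "CHAR('a)" E2] finite_binomial_support
    by (intro degree_sum_le) (auto intro: order_trans[OF degree_monom_le])
  moreover have "\<forall>x. Polynomial.poly ?P x = h x ^ T"
    by (simp add: c poly_sum poly_monom)
  ultimately show ?thesis by blast
qed

text \<open>
  Let \<open>d j\<close> be the degree of the reduced polynomial of \<open>h ^ (q ^ j)\<close>. The products of two of these
  polynomials are still reduced, so \<open>d i + d j\<close> is at most the exponent \<open>N\<close> of the norm for
  \<open>i \<noteq> j\<close> modulo \<open>n\<close>. Hence \<open>d (j + 1) = q * d j\<close> unless \<open>d j\<close> is the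
  maximum \<open>d m\<close>, which forces \<open>d m = q ^ (n - 1) * d (m + 1)\<close> and then \<open>d (m + 1) = 1\<close>.
\<close>
lemma norm_isometry_is_Frobenius_power:
  fixes h :: "'a::{field,finite} \<Rightarrow> 'a"
  assumes p: "Factorial_Ring.prime CHAR('a)" and q: "q = CHAR('a) ^ k" and k: "k \<ge> 1" and q2: "q > 2"
    and n: "n \<ge> 1" and card: "card (UNIV :: 'a set) = q ^ n"
    and h: "bij h" "h 0 = 0" "h 1 = 1"
    and eq: "\<And>x y. (h x - h y) ^ (\<Sum>j<n. q ^ j) = (x - y) ^ (\<Sum>j<n. q ^ j)"
  shows "\<exists>j. \<forall>x. h x ^ (q ^ j) = x"
proof -
  let ?N = "\<Sum>j<n. q ^ j" and ?Q = "card (UNIV :: 'a set)"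
  have Q: "(q - 1) * ?N + 1 = ?Q" using geometric_sum_mult[of q n] q2 card by simp
  have N_pos: "?N \<ge> 1" using n q2 by (cases n) (auto simp: Suc_le_eq)
  \<comment> \<open>Here \<open>q > 2\<close> leads to \<open>2 * ?N < ?Q\<close>, so a product of
    two polynomials of degree at most \<open>?N\<close> is determined by its values.\<close>
  have "2 * ?N \<le> (q - 1) * ?N" using q2 by (intro mult_right_mono) auto
  hence N: "2 * ?N < ?Q" using Q by linarith
  hence N': "?N < ?Q - 1" using N_pos by linarith
  note wrap = Frobenius_power_mod[OF card]
  have "\<exists>P. Polynomial.degree P \<le> ?N \<and> (\<forall>x. Polynomial.poly P x = h x ^ (q ^ j))" for j
  proof -
    have "j mod n < n" using n by simp
    from degree_bound_of_differences[OF h(1) eq N', of "q ^ (j mod n)"]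
      of_nat_geometric_sum_choose(1)[OF p q k this]
    show ?thesis by (simp add: wrap)
  qed
  then obtain R where R: "\<And>j. Polynomial.degree (R j) \<le> ?N" "\<And>j x. Polynomial.poly (R j) x = h x ^ (q ^ j)"
    by metis
  define d where "d j = Polynomial.degree (R j)" for j
  have R0: "R j \<noteq> 0" for j
    using R(2)[of j 1] h by auto
  have R_less: "Polynomial.degree (R j) < ?Q" for j
    using R(1)[of j] N by linarith
  have wrap_d: "d (j mod n) = d j" for j
  proof -
    have "R (j mod n) = R j"
      by (rule poly_eqI_finite_field[OF _ R_less R_less]) (simp add: R(2) wrap)
    thus ?thesis by (simp add: d_def)
  qed
  have d_sum_lt: "d i + d j \<le> ?N" if ij: "i < j" "j < n" for i j
  proof -
    obtain P where P: "Polynomial.degree P \<le> ?N" "\<And>x. Polynomial.poly P x = h x ^ (q ^ i + q ^ j)"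
      using degree_bound_of_differences[OF h(1) eq N', of "q ^ i + q ^ j"]
        of_nat_geometric_sum_choose(2)[OF p q k ij] by auto
    have deg: "Polynomial.degree (R i * R j) = d i + d j"
      using R0 by (simp add: degree_mult_eq d_def)
    have "d i + d j < ?Q" using R(1)[of i] R(1)[of j] N by (simp add: d_def)
    \<comment> \<open>Both sides represent \<open>h ^ (q ^ i + q ^ j)\<close> with degree below
      \<open>?Q\<close>, so they agree as polynomials and their degrees can be compared.\<close>
    hence "R i * R j = P"
      using P N deg by (intro poly_eqI_finite_field) (auto simp: R power_add)
    thus ?thesis using P deg by metis
  qed
  have d_sum: "d i + d j \<le> ?N" if "i mod n \<noteq> j mod n" for i j
  proof -
    have "i mod n < n" "j mod n < n" using n by simp_all
    hence "d (i mod n) + d (j mod n) \<le> ?N"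
      using d_sum_lt[of "i mod n" "j mod n"] d_sum_lt[of "j mod n" "i mod n"] that
      by (cases "i mod n < j mod n") (auto simp: add.commute)
    thus ?thesis by (simp add: wrap_d)
  qed
  have d_Suc: "d (Suc j) = q * d j" if "q * d j < ?Q" for j
  proof -
    have deg: "Polynomial.degree (R j ^ q) = q * d j"
      using R0 by (simp add: degree_power_eq d_def)
    have "R (Suc j) = R j ^ q"
      using that R_less deg by (intro poly_eqI_finite_field) (simp_all add: R mult.commute flip: power_mult)
    thus ?thesis using deg by (simp add: d_def)
  qed
  have "Max (d ` {..<n}) \<in> d ` {..<n}" using n by (intro Max_in) (auto simp: lessThan_empty_iff)
  then obtain m where m: "m < n" "d m = Max (d ` {..<n})" by auto
  have m_max: "d i \<le> d m" if "i < n" for i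
    unfolding m(2) using that by (intro Max_ge) auto
  \<comment> \<open>Away from the index \<open>m\<close> of the maximum, twice \<open>d i\<close> is
    at most \<open>d i + d m\<close>, hence at most \<open>?N\<close>; then
    \<open>q * d i \<le> (q - 1) * ?N < ?Q\<close> because
    \<open>q \<le> 2 * (q - 1)\<close>.\<close>
  have small: "q * d i < ?Q" if "i mod n \<noteq> m" for i
  proof -
    have "i mod n < n" using n by simp
    hence "d i \<le> d m" using m_max[of "i mod n"] by (simp add: wrap_d)
    moreover have "d i + d m \<le> ?N" using d_sum[of i m] that m(1) by simp
    ultimately have "2 * d i \<le> ?N" by simp
    hence "q * (2 * d i) \<le> q * ?N" by (rule mult_left_mono) simp
    also have "\<dots> \<le> (2 * (q - 1)) * ?N" using q2 by (intro mult_right_mono) auto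
    finally have "q * d i \<le> (q - 1) * ?N" by simp
    thus ?thesis using Q by linarith
  qed
  \<comment> \<open>Starting right after \<open>m\<close>, the first \<open>n - 1\<close> steps
    avoid \<open>m\<close> modulo \<open>n\<close>, so each multiplies the degree by
    \<open>q\<close>.\<close>
  have grow: "d (Suc m + i) = q ^ i * d (Suc m)" if "i < n" for i
    using that
  proof (induction i)
    case (Suc i)
    have "(Suc m + i) mod n \<noteq> m"
    proof
      assume "(Suc m + i) mod n = m"
      hence "(m + Suc i) mod n = m mod n" using m(1) by simp
      hence "n dvd Suc i" by (metis add_diff_cancel_left' le_add1 mod_eq_dvd_iff_nat)
      thus False using Suc.prems by (auto dest: dvd_imp_le)
    qed
    from d_Suc[OF small[OF this]] Suc show ?case by simp
  qed simp
  have "q ^ (n - 1) * d (Suc m) \<le> ?N"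
    using grow[of "n - 1"] n R(1)[of "Suc m + (n - 1)"] unfolding d_def[symmetric] by simp
  also have "?N < 2 * q ^ (n - 1)"
  proof -
    have "(q - 1) * ?N < q ^ n" using Q card by simp
    also have "\<dots> = q * q ^ (n - 1)" using n by (cases n) auto
    also have "\<dots> \<le> (2 * (q - 1)) * q ^ (n - 1)" using q2 by (intro mult_right_mono) auto
    also have "\<dots> = (q - 1) * (2 * q ^ (n - 1))" by simp
    finally show ?thesis using q2 by (simp only: mult_less_cancel1)
  qed
  finally have "d (Suc m) \<le> 1" using q2 by simp
  hence deg1: "R (Suc m) = [:Polynomial.coeff (R (Suc m)) 0, Polynomial.coeff (R (Suc m)) 1:]"
    unfolding d_def by (intro poly_eqI) (auto simp: coeff_pCons coeff_eq_0 split: nat.split)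
  define a b where "a = Polynomial.coeff (R (Suc m)) 0" and "b = Polynomial.coeff (R (Suc m)) 1"
  have *: "h x ^ (q ^ Suc m) = a + x * b" for x
    using R(2)[of "Suc m" x] by (subst (asm) deg1) (simp add: a_def b_def)
  \<comment> \<open>The normalisation \<open>h 0 = 0\<close>, \<open>h 1 = 1\<close> fixes both
    coefficients, which also rules out degree 0.\<close>
  have "a = h 0 ^ (q ^ Suc m)" using *[of 0] by simp
  also have "\<dots> = 0" unfolding h(2) using q2 by (intro zero_power) simp
  finally have "a = 0" .
  moreover from this have "b = 1" using *[of 1] h by simp
  ultimately show ?thesis using * by (intro exI[of _ "Suc m"]) simp
qed

lemma Frobenius_diff:
  fixes x y :: "'a::field"
  assumes "Factorial_Ring.prime CHAR('a)"
  shows "(x - y) ^ (CHAR('a) ^ i) = x ^ (CHAR('a) ^ i) - y ^ (CHAR('a) ^ i)"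
  using freshmans_dream'[OF assms refl, of "x - y" y i] by (simp add: algebra_simps)

lemma norm_semi_isometry_is_Frobenius_power:
  fixes h :: "'a::{field,finite} \<Rightarrow> 'a"
  assumes p: "Factorial_Ring.prime CHAR('a)" and q: "q = CHAR('a) ^ k" and k: "k \<ge> 1" and q2: "q > 2"
    and n: "n \<ge> 1" and card: "card (UNIV :: 'a set) = q ^ n"
    and h: "bij h" "h 0 = 0" "h 1 = 1" and e: "e < q - 1"
    and eq: "\<And>x y. (h x - h y) ^ (\<Sum>j<n. q ^ j) = (x - y) ^ ((\<Sum>j<n. q ^ j) * e)"
  shows "\<exists>i < k * n. \<forall>x. h x = x ^ (CHAR('a) ^ i)"
proof -
  let ?N = "\<Sum>j<n. q ^ j" and ?Q = "card (UNIV :: 'a set)" and ?p = "CHAR('a)"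
  have cardp: "?Q = ?p ^ (k * n)" unfolding card q by (simp add: power_mult)
  have kn: "k * n > 0" using k n by simp
  have fixp: "x ^ (?p ^ (k * n * c)) = x" for x :: 'a and c
    using Frobenius_power_mod[OF cardp, of x "k * n * c"] by simp
  have Q: "(q - 1) * ?N + 1 = ?Q" using geometric_sum_mult[of q n] q2 card by simp
  have N_pos: "?N \<ge> 1" using n q2 by (cases n) (auto simp: Suc_le_eq)
  \<comment> \<open>For \<open>e = 0\<close> the case \<open>x = y = 0\<close> would equate
    \<open>0 ^ ?N = 0\<close> with \<open>0 ^ 0 = 1\<close>.\<close>
  have e0: "e > 0"
  proof (rule ccontr)
    assume "\<not> e > 0"
    moreover have "(0 :: 'a) ^ ?N = 0" using N_pos by (intro zero_power) linarith
    ultimately show False using eq[of 0 0] by (simp only: diff_self h) simp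
  qed
  have "2 * ?N \<le> (q - 1) * ?N" using q2 by (intro mult_right_mono) auto
  hence N1: "?N < ?Q - 1" using Q N_pos by linarith
  have "?N * e < ?N * (q - 1)" using e N_pos by simp
  hence N2: "?N * e < ?Q - 1" using Q mult.commute[of ?N "q - 1"] by linarith
  have le: "card (binomial_support ?p ?N) \<le> card (binomial_support ?p (?N * e))"
    using card_binomial_support_le[OF h(1) eq N1] .
  \<comment> \<open>The inverse of \<open>h\<close> satisfies the same identity with the two
    exponents exchanged, so both supports have the same size.\<close>
  have "bij (inv_into UNIV h)" using h(1) by (rule bij_imp_bij_inv)
  moreover have "(inv_into UNIV h x - inv_into UNIV h y) ^ (?N * e) = (x - y) ^ ?N" for x y
    using eq[of "inv_into UNIV h x" "inv_into UNIV h y"] h(1) by (simp add: bij_is_surj surj_f_inv_f)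
  ultimately have ge: "card (binomial_support ?p (?N * e)) \<le> card (binomial_support ?p ?N)"
    using card_binomial_support_le[OF _ _ N2] by blast
  have "binomial_support ?p 1 = {0, 1}"
    using binomial_support_subset[of "?p" 1] p by (auto simp: binomial_support_def le_Suc_eq)
  hence "card (binomial_support ?p e) ^ n = 2 ^ n"
    using le ge card_binomial_support_geometric[OF p q, of 1 n] card_binomial_support_geometric[OF p q, of e n] e q2
    by (simp add: numeral_2_eq_2)
  hence "card (binomial_support ?p e) = 2"
    using n by (simp add: power_eq_iff_eq_base)
  then obtain i where i: "e = ?p ^ i"
    using prime_power_if_card_binomial_support_eq_2[OF p e0] by blast
  \<comment> \<open>\<open>s + i\<close> is a multiple of \<open>k * n\<close>, so raising to
    \<open>?p ^ s\<close> cancels the exponent \<open>e = ?p ^ i\<close> on the field.\<close>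
  define s where "s = k * n * i - i"
  have si: "s + i = k * n * i" using kn by (simp add: s_def)
  define g where "g x = h x ^ (?p ^ s)" for x
  have frob_inj: "x = y" if "x ^ (?p ^ s) = y ^ (?p ^ s)" for x y :: 'a
  proof -
    have "(x ^ (?p ^ s)) ^ (?p ^ i) = (y ^ (?p ^ s)) ^ (?p ^ i)" using that by simp
    thus ?thesis by (simp add: si fixp flip: power_mult power_add)
  qed
  have "inj g"
  proof (rule injI)
    fix x y assume "g x = g y"
    hence "h x = h y" unfolding g_def by (rule frob_inj)
    thus "x = y" using h(1) by (meson bij_is_inj injD)
  qed
  hence "bij g" by (simp add: bij_def finite_UNIV_inj_surj)
  moreover have "(g x - g y) ^ ?N = (x - y) ^ ?N" for x y
  proof -
    have "(g x - g y) ^ ?N = ((h x - h y) ^ ?N) ^ (?p ^ s)"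
      by (simp add: g_def Frobenius_diff[OF p, symmetric] mult.commute flip: power_mult)
    also have "\<dots> = ((x - y) ^ ?N) ^ (?p ^ (s + i))"
      unfolding eq i by (simp add: power_add mult_ac flip: power_mult)
    also have "\<dots> = (x - y) ^ ?N" by (simp only: si fixp)
    finally show ?thesis .
  qed
  moreover have "g 0 = 0" "g 1 = 1"
    using h prime_gt_0_nat[OF p] by (simp_all add: g_def)
  ultimately obtain j where j: "\<And>x. g x ^ (q ^ j) = x"
    using norm_isometry_is_Frobenius_power[OF p q k q2 n card, of g] by blast
  define r where "r = s + k * j"
  have hr: "h x ^ (?p ^ r) = x" for x
  proof -
    have "h x ^ (?p ^ r) = (h x ^ (?p ^ s)) ^ ((?p ^ k) ^ j)"
      unfolding r_def by (simp only: power_add power_mult)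
    thus ?thesis using j[of x] unfolding g_def q by (rule trans)
  qed
  have "h x = x ^ (?p ^ ((k * n * r - r) mod (k * n)))" for x
  proof -
    have r: "r + (k * n * r - r) = k * n * r" using kn by simp
    have "h x = h x ^ (?p ^ (r + (k * n * r - r)))" unfolding r fixp ..
    also have "\<dots> = (h x ^ (?p ^ r)) ^ (?p ^ (k * n * r - r))"
      by (simp only: power_add power_mult)
    finally have "h x = (h x ^ (?p ^ r)) ^ (?p ^ (k * n * r - r))" .
    thus ?thesis unfolding Frobenius_power_mod[OF cardp] hr .
  qed
  thus ?thesis using kn by (intro exI[of _ "(k * n * r - r) mod (k * n)"]) simp
qed

section \<open>Semidirect products with a cyclic complement\<close>

text \<open>Since \<open>\<sigma>\<close> normalises the image of \<open>\<eta>\<close>, conjugation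
  by its powers acts on \<open>N\<close>, and \<open>(u, i)\<close> is sent to
  \<open>\<eta> u \<otimes> \<sigma> [^] i\<close>; \<open>uniq\<close> makes the exponent in this
  factorisation unique. Closure under multiplication passes from \<open>N\<close> to the product, so
  the construction can be repeated with a semidirect product as \<open>N\<close>.\<close>

lemma semidirect_product_cyclic_embedding:
  fixes G (structure) and N :: "('n, 'x) monoid_scheme"
  assumes "group G" and m: "m > (0 :: nat)"
    and hom: "\<eta> \<in> hom N G" and inj: "inj_on \<eta> (carrier N)"
    and closed: "\<And>u v. u \<in> carrier N \<Longrightarrow> v \<in> carrier N \<Longrightarrow> u \<otimes>\<^bsub>N\<^esub> v \<in> carrier N"
    and \<sigma>: "\<sigma> \<in> carrier G" "\<sigma> [^] m = \<one>"
    and conj: "\<And>u. u \<in> carrier N \<Longrightarrow> \<exists>v\<in>carrier N. \<sigma> \<otimes> \<eta> u = \<eta> v \<otimes> \<sigma>"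
    and uniq: "\<And>u v i j. u \<in> carrier N \<Longrightarrow> v \<in> carrier N \<Longrightarrow> i < m \<Longrightarrow> j < m \<Longrightarrow>
                 \<eta> u \<otimes> \<sigma> [^] i = \<eta> v \<otimes> \<sigma> [^] j \<Longrightarrow> i = j"
  obtains \<phi> \<Theta> where
    "\<phi> \<in> hom (integer_mod_group m) (AutoGroup N)"
    "\<Theta> \<in> hom (semidirect_product N (integer_mod_group m) \<phi>) G"
    "inj_on \<Theta> (carrier (semidirect_product N (integer_mod_group m) \<phi>))"
    "\<Theta> ` carrier (semidirect_product N (integer_mod_group m) \<phi>) =
       {\<eta> u \<otimes> \<sigma> [^] i | u i. u \<in> carrier N \<and> i < m}"
    "\<And>x y. x \<in> carrier (semidirect_product N (integer_mod_group m) \<phi>) \<Longrightarrow>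
       y \<in> carrier (semidirect_product N (integer_mod_group m) \<phi>) \<Longrightarrow>
       x \<otimes>\<^bsub>semidirect_product N (integer_mod_group m) \<phi>\<^esub> y
         \<in> carrier (semidirect_product N (integer_mod_group m) \<phi>)"
proof -
  interpret group G by fact
  have car: "carrier (integer_mod_group m) = {0..<int m}"
    using m by (simp add: carrier_integer_mod_group)
  have \<eta>_closed [simp]: "\<eta> u \<in> carrier G" if "u \<in> carrier N" for u
    using hom that by (auto simp: hom_def)
  have \<eta>_mult: "\<eta> (u \<otimes>\<^bsub>N\<^esub> v) = \<eta> u \<otimes> \<eta> v" if "u \<in> carrier N" "v \<in> carrier N" for u v
    using hom that by (auto simp: hom_def)
  note [simp] = \<sigma>(1)
  have ex: "\<exists>v\<in>carrier N. \<sigma> [^] i \<otimes> \<eta> u = \<eta> v \<otimes> \<sigma> [^] i" if "u \<in> carrier N" for i :: nat and u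
  proof (induction i)
    case (Suc i)
    then obtain v where v: "v \<in> carrier N" "\<sigma> [^] i \<otimes> \<eta> u = \<eta> v \<otimes> \<sigma> [^] i" by blast
    obtain v' where v': "v' \<in> carrier N" "\<sigma> \<otimes> \<eta> v = \<eta> v' \<otimes> \<sigma>" using conj v by blast
    have "\<sigma> [^] Suc i \<otimes> \<eta> u = \<sigma> \<otimes> (\<sigma> [^] i \<otimes> \<eta> u)"
      using that by (simp only: nat_pow_Suc2[OF \<sigma>(1)] m_assoc \<sigma> nat_pow_closed \<eta>_closed)
    also have "\<dots> = (\<sigma> \<otimes> \<eta> v) \<otimes> \<sigma> [^] i" using v by (simp add: m_assoc)
    also have "\<dots> = \<eta> v' \<otimes> (\<sigma> \<otimes> \<sigma> [^] i)" using v' v by (simp add: m_assoc)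
    also have "\<dots> = \<eta> v' \<otimes> \<sigma> [^] Suc i" by (simp only: nat_pow_Suc2[OF \<sigma>(1)])
    finally show ?case using v' by blast
  qed (use that in auto)
  \<comment> \<open>\<open>conj\<close> only yields existence; injectivity of \<open>\<eta>\<close>
    makes \<open>c i u\<close> the unique conjugate, which is how its laws are checked.\<close>
  define c where "c i u = (SOME v. v \<in> carrier N \<and> \<sigma> [^] i \<otimes> \<eta> u = \<eta> v \<otimes> \<sigma> [^] i)" for i :: nat and u
  have c: "c i u \<in> carrier N" "\<sigma> [^] i \<otimes> \<eta> u = \<eta> (c i u) \<otimes> \<sigma> [^] i" if "u \<in> carrier N" for i u
    using someI_ex[of "\<lambda>v. v \<in> carrier N \<and> \<sigma> [^] i \<otimes> \<eta> u = \<eta> v \<otimes> \<sigma> [^] i"] ex[OF that, of i]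
    unfolding c_def by blast+
  have c_eqI: "c i u = v"
    if "u \<in> carrier N" "v \<in> carrier N" "\<sigma> [^] i \<otimes> \<eta> u = \<eta> v \<otimes> \<sigma> [^] i" for i u v
  proof -
    have "\<eta> (c i u) \<otimes> \<sigma> [^] i = \<eta> v \<otimes> \<sigma> [^] i" using c that by simp
    hence "\<eta> (c i u) = \<eta> v" using that c(1)[of u i] by (simp add: r_cancel)
    thus ?thesis using inj that c by (auto dest: inj_onD)
  qed
  have c_add: "c (i + j) u = c i (c j u)" if "u \<in> carrier N" for i j u
  proof (rule c_eqI)
    have "\<sigma> [^] (i + j) \<otimes> \<eta> u = \<sigma> [^] i \<otimes> (\<sigma> [^] j \<otimes> \<eta> u)"
      using that by (simp add: m_assoc flip: nat_pow_mult)
    also have "\<dots> = (\<sigma> [^] i \<otimes> \<eta> (c j u)) \<otimes> \<sigma> [^] j"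
      using that c(1) by (simp add: m_assoc c(2)[of u j])
    also have "\<dots> = (\<eta> (c i (c j u)) \<otimes> \<sigma> [^] i) \<otimes> \<sigma> [^] j"
      using that c by simp
    also have "\<dots> = \<eta> (c i (c j u)) \<otimes> \<sigma> [^] (i + j)"
      using that c(1) by (simp add: m_assoc nat_pow_mult)
    finally show "\<sigma> [^] (i + j) \<otimes> \<eta> u = \<eta> (c i (c j u)) \<otimes> \<sigma> [^] (i + j)" .
  qed (use that c in auto)
  have pow_mod: "\<sigma> [^] (i mod m) = \<sigma> [^] i" for i
  proof -
    have "\<sigma> [^] i = \<sigma> [^] (m * (i div m) + i mod m)" by simp
    also have "\<dots> = (\<sigma> [^] m) [^] (i div m) \<otimes> \<sigma> [^] (i mod m)"
      by (simp only: nat_pow_mult[OF \<sigma>(1), symmetric] nat_pow_pow[OF \<sigma>(1)])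
    finally show ?thesis by (simp add: \<sigma>)
  qed
  have c_mod: "c (i mod m) u = c i u" if "u \<in> carrier N" for i u
    using that c by (intro c_eqI) (auto simp: pow_mod)
  have c_0: "c 0 u = u" if "u \<in> carrier N" for u
    using that by (intro c_eqI) auto
  have c_mult: "c i (u \<otimes>\<^bsub>N\<^esub> v) = c i u \<otimes>\<^bsub>N\<^esub> c i v" if "u \<in> carrier N" "v \<in> carrier N" for i u v
  proof (rule c_eqI)
    have "\<sigma> [^] i \<otimes> \<eta> (u \<otimes>\<^bsub>N\<^esub> v) = \<sigma> [^] i \<otimes> \<eta> u \<otimes> \<eta> v"
      using that by (simp add: \<eta>_mult m_assoc)
    also have "\<dots> = \<eta> (c i u) \<otimes> (\<sigma> [^] i \<otimes> \<eta> v)"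
      using that c by (simp add: m_assoc)
    also have "\<dots> = \<eta> (c i u \<otimes>\<^bsub>N\<^esub> c i v) \<otimes> \<sigma> [^] i"
      using that c by (simp add: m_assoc \<eta>_mult)
    finally show "\<sigma> [^] i \<otimes> \<eta> (u \<otimes>\<^bsub>N\<^esub> v) = \<eta> (c i u \<otimes>\<^bsub>N\<^esub> c i v) \<otimes> \<sigma> [^] i" .
  qed (use that c closed in auto)
  \<comment> \<open>The elements of \<open>integer_mod_group m\<close> are integers, hence
    \<open>nat\<close>; the restriction makes each value extensional, as \<open>Bij\<close>
    demands.\<close>
  define \<phi> where "\<phi> i = restrict (c (nat i)) (carrier N)" for i
  \<comment> \<open>\<open>m * i - i\<close> stands in for the exponent \<open>- i\<close>, since
    \<open>c\<close> depends on its index only modulo \<open>m\<close>.\<close>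
  have c_cancel: "c (m * i - i) (c i u) = u" "c i (c (m * i - i) u) = u" if "u \<in> carrier N" for i u
  proof -
    have "(m * i - i) + i = m * i" "i + (m * i - i) = m * i" using m by auto
    moreover have "c (m * i) u = u" using c_mod[OF that, of "m * i"] c_0 that by simp
    ultimately show "c (m * i - i) (c i u) = u" "c i (c (m * i - i) u) = u"
      using c_add[OF that] by metis+
  qed
  have bij: "bij_betw (c i) (carrier N) (carrier N)" for i
    by (rule bij_betw_byWitness[where f' = "c (m * i - i)"]) (use c c_cancel in auto)
  have \<phi>_Bij: "\<phi> i \<in> Bij (carrier N)" for i
    using bij[of "nat i"] by (simp add: Bij_def \<phi>_def)
  have \<phi>_auto: "\<phi> i \<in> auto N" for i
    using \<phi>_Bij c closed by (auto simp: auto_def hom_def \<phi>_def c_mult)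
  let ?Z = "integer_mod_group m"
  let ?S = "semidirect_product N ?Z \<phi>"
  have carS: "carrier ?S = carrier N \<times> {0..<int m}"
    by (simp add: semidirect_product_def car)
  have multS: "(u, i) \<otimes>\<^bsub>?S\<^esub> (v, j) = (u \<otimes>\<^bsub>N\<^esub> \<phi> i v, (i + j) mod int m)" for u i v j
    by (simp add: semidirect_product_def)
  have nat_mod: "nat ((i + j) mod int m) = (nat i + nat j) mod m" if "0 \<le> i" "0 \<le> j" for i j
    using that by (simp add: nat_mod_distrib nat_add_distrib)
  have \<phi>_hom: "\<phi> \<in> hom ?Z (AutoGroup N)"
  proof (rule homI)
    fix i assume "i \<in> carrier ?Z"
    show "\<phi> i \<in> carrier (AutoGroup N)" using \<phi>_auto by (simp add: AutoGroup_def)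
  next
    fix i j assume ij: "i \<in> carrier ?Z" "j \<in> carrier ?Z"
    have "\<phi> ((i + j) mod int m) = compose (carrier N) (\<phi> i) (\<phi> j)"
      using ij c by (auto simp: \<phi>_def compose_def car nat_mod c_mod c_add fun_eq_iff)
    thus "\<phi> (i \<otimes>\<^bsub>?Z\<^esub> j) = \<phi> i \<otimes>\<^bsub>AutoGroup N\<^esub> \<phi> j"
      using \<phi>_Bij by (simp add: AutoGroup_def BijGroup_def)
  qed
  define \<Theta> where "\<Theta> = (\<lambda>(u, i). \<eta> u \<otimes> \<sigma> [^] nat i)"
  have closedS: "x \<otimes>\<^bsub>?S\<^esub> y \<in> carrier ?S" if "x \<in> carrier ?S" "y \<in> carrier ?S" for x y
    using that m c closed by (cases x; cases y) (auto simp: carS multS \<phi>_def)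
  have \<Theta>_hom: "\<Theta> \<in> hom ?S G"
  proof (rule homI)
    fix x assume "x \<in> carrier ?S"
    thus "\<Theta> x \<in> carrier G" by (auto simp: carS \<Theta>_def)
  next
    fix x y assume xy: "x \<in> carrier ?S" "y \<in> carrier ?S"
    obtain u i v j where [simp]: "x = (u, i)" "y = (v, j)" by (cases x; cases y)
    have uv: "u \<in> carrier N" "v \<in> carrier N" "0 \<le> i" "0 \<le> j" using xy by (auto simp: carS)
    have "\<Theta> (x \<otimes>\<^bsub>?S\<^esub> y) = \<eta> u \<otimes> \<eta> (c (nat i) v) \<otimes> \<sigma> [^] (nat i + nat j)"
      using uv c by (simp add: multS \<Theta>_def \<phi>_def \<eta>_mult nat_mod pow_mod)
    also have "\<dots> = \<eta> u \<otimes> (\<eta> (c (nat i) v) \<otimes> \<sigma> [^] nat i) \<otimes> \<sigma> [^] nat j"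
      using uv c by (simp add: m_assoc flip: nat_pow_mult)
    also have "\<dots> = \<eta> u \<otimes> (\<sigma> [^] nat i \<otimes> \<eta> v) \<otimes> \<sigma> [^] nat j"
      by (simp only: c(2)[OF uv(2)])
    also have "\<dots> = \<Theta> x \<otimes> \<Theta> y" using uv by (simp add: \<Theta>_def m_assoc)
    finally show "\<Theta> (x \<otimes>\<^bsub>?S\<^esub> y) = \<Theta> x \<otimes> \<Theta> y" .
  qed
  have \<Theta>_inj: "inj_on \<Theta> (carrier ?S)"
  proof (rule inj_onI)
    fix x y assume xy: "x \<in> carrier ?S" "y \<in> carrier ?S" "\<Theta> x = \<Theta> y"
    obtain u i v j where [simp]: "x = (u, i)" "y = (v, j)" by (cases x; cases y)
    have uv: "u \<in> carrier N" "v \<in> carrier N" "0 \<le> i" "0 \<le> j" "i < int m" "j < int m"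
      using xy by (auto simp: carS)
    have eq: "\<eta> u \<otimes> \<sigma> [^] nat i = \<eta> v \<otimes> \<sigma> [^] nat j" using xy by (simp add: \<Theta>_def)
    have ij: "nat i = nat j" using uv by (intro uniq[OF _ _ _ _ eq]) auto
    have "\<eta> u = \<eta> v" using eq uv by (simp add: ij r_cancel)
    hence "u = v" using inj_onD[OF inj] uv by blast
    moreover have "i = j" using ij uv by linarith
    ultimately show "x = y" by simp
  qed
  have \<Theta>_img: "\<Theta> ` carrier ?S = {\<eta> u \<otimes> \<sigma> [^] i | u i. u \<in> carrier N \<and> i < m}"
  proof (intro equalityI subsetI)
    fix g assume "g \<in> \<Theta> ` carrier ?S"
    then obtain u i where ui: "u \<in> carrier N" "0 \<le> i" "i < int m" "g = \<eta> u \<otimes> \<sigma> [^] nat i"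
      by (auto simp: carS \<Theta>_def)
    moreover from ui have "nat i < m" by linarith
    ultimately show "g \<in> {\<eta> u \<otimes> \<sigma> [^] i | u i. u \<in> carrier N \<and> i < m}" by blast
  next
    fix g assume "g \<in> {\<eta> u \<otimes> \<sigma> [^] i | u i. u \<in> carrier N \<and> i < m}"
    then obtain u i where ui: "u \<in> carrier N" "i < m" "g = \<eta> u \<otimes> \<sigma> [^] i" by blast
    hence "g = \<Theta> (u, int i)" by (simp add: \<Theta>_def)
    thus "g \<in> \<Theta> ` carrier ?S" using ui by (intro image_eqI) (auto simp: carS)
  qed
  show ?thesis by (rule that[OF \<phi>_hom \<Theta>_hom \<Theta>_inj \<Theta>_img closedS])
qed

text \<open>The map out of the explicit product is the easy one to write down; this turns it round.
  The inverse is multiplicative by injectivity of \<open>\<Theta>\<close>, once products stay inside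
  \<open>carrier S\<close>.\<close>

lemma iso_sym_of_closed:
  assumes "\<Theta> \<in> hom S G" "inj_on \<Theta> (carrier S)" "\<Theta> ` carrier S = carrier G"
    and "\<And>x y. x \<in> carrier S \<Longrightarrow> y \<in> carrier S \<Longrightarrow> x \<otimes>\<^bsub>S\<^esub> y \<in> carrier S"
  shows "G \<cong> S"
proof (rule is_isoI)
  let ?\<Psi> = "inv_into (carrier S) \<Theta>"
  have \<Psi>: "?\<Psi> g \<in> carrier S" "\<Theta> (?\<Psi> g) = g" if "g \<in> carrier G" for g
    using that assms(3) by (auto intro: inv_into_into f_inv_into_f)
  have "bij_betw ?\<Psi> (carrier G) (carrier S)"
    using assms by (intro bij_betw_inv_into) (simp add: bij_betw_def)
  moreover have "?\<Psi> \<in> hom G S"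
  proof (rule homI)
    fix g h assume gh: "g \<in> carrier G" "h \<in> carrier G"
    have "\<Theta> (?\<Psi> g \<otimes>\<^bsub>S\<^esub> ?\<Psi> h) = g \<otimes>\<^bsub>G\<^esub> h"
      using hom_mult[OF assms(1)] gh \<Psi> by simp
    thus "?\<Psi> (g \<otimes>\<^bsub>G\<^esub> h) = ?\<Psi> g \<otimes>\<^bsub>S\<^esub> ?\<Psi> h"
      using assms(2,4) gh \<Psi> by (metis inv_into_f_f)
  qed (use \<Psi> in auto)
  ultimately show "?\<Psi> \<in> iso G S" by (simp add: iso_def)
qed

section \<open>Projective norm graphs\<close>

locale projective_norm_graph =
  fixes p k q t :: nat and K :: "'a::{field,finite} set"
  assumes prime_p: "Factorial_Ring.prime p" and k: "k \<ge> 1" and q: "q = p ^ k" and t: "t \<ge> 2"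
    and card_UNIV: "card (UNIV :: 'a set) = q ^ (t - 1)"
    and subfield: "subfield K (ring_of_type_algebra :: 'a ring)" and card_K: "card K = q"
begin

abbreviation "N \<equiv> field_norm q t :: 'a \<Rightarrow> 'a"
abbreviation "V \<equiv> NG_verts K"
abbreviation "E \<equiv> NG_adj q t :: 'a \<times> 'a \<Rightarrow> 'a \<times> 'a \<Rightarrow> bool"
abbreviation "\<nu> \<equiv> \<Sum>j<t - 1. q ^ j"

lemma Q_eq: "card (UNIV :: 'a set) = p ^ (k * (t - 1))"
  by (simp add: card_UNIV q power_mult)

lemma CHAR_eq: "CHAR('a) = p"
proof -
  have pos: "CHAR('a) > 0" by (rule finite_imp_CHAR_pos) simp
  hence "Factorial_Ring.prime CHAR('a)" by (rule prime_CHAR_semidom)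
  moreover have "CHAR('a) dvd p ^ (k * (t - 1))"
    using of_nat_card_UNIV[where ?'a = 'a] unfolding Q_eq of_nat_eq_0_iff_char_dvd .
  ultimately show ?thesis
    using prime_p prime_dvd_power primes_dvd_imp_eq by blast
qed

lemma prime_char: "Factorial_Ring.prime CHAR('a)"
  using prime_p by (simp add: CHAR_eq)

lemma q_ge_2: "q \<ge> 2"
  using prime_ge_2_nat[OF prime_p] self_le_power[of p k] k unfolding q by linarith

lemma field_norm_eq: "N x = x ^ \<nu>"
proof -
  have "{0..t - 2} = {..<t - 1}" using t by auto
  thus ?thesis by (simp add: field_norm_def)
qed

lemma \<nu>_pos: "\<nu> > 0"
proof -
  have "q ^ 0 \<le> \<nu>" using t by (intro member_le_sum) auto
  thus ?thesis by simp
qed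

lemma \<nu>_mult: "(q - 1) * \<nu> = card (UNIV :: 'a set) - 1"
  using geometric_sum_mult[of q "t - 1"] q_ge_2 by (simp add: card_UNIV)

lemma norm_mult: "N (x * y) = N x * N y"
  by (simp add: field_norm_eq power_mult_distrib)

lemma norm_divide: "N (x / y) = N x / N y"
  by (simp add: field_norm_eq power_divide)

lemma norm_power: "N (x ^ i) = N x ^ i"
  by (simp add: field_norm_eq mult.commute flip: power_mult)

lemma norm_eq_0_iff [simp]: "N x = 0 \<longleftrightarrow> x = 0"
  unfolding field_norm_eq using \<nu>_pos by (simp only: power_eq_0_iff) blast

lemma norm_0 [simp]: "N 0 = 0" and norm_1 [simp]: "N 1 = 1"
  by simp (simp add: field_norm_eq)

lemma subfield_facts:
  shows "0 \<in> K" "1 \<in> K" "\<And>x y. x \<in> K \<Longrightarrow> y \<in> K \<Longrightarrow> x * y \<in> K"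
    and "\<And>x. x \<in> K \<Longrightarrow> x \<noteq> 0 \<Longrightarrow> \<exists>y\<in>K. x * y = 1"
proof -
  interpret subfield K "ring_of_type_algebra :: 'a ring" by (rule subfield)
  interpret R: Ring.field "ring_of_type_algebra :: 'a ring" by (rule field_from_type_algebra)
  note subring_props = subringE[OF subfieldE(1)[OF subfield]]
  show "0 \<in> K" "1 \<in> K" "\<And>x y. x \<in> K \<Longrightarrow> y \<in> K \<Longrightarrow> x * y \<in> K"
    using subring_props(2,3,6) by (auto simp: ring_of_type_algebra_def)
  show "\<exists>y\<in>K. x * y = 1" if "x \<in> K" "x \<noteq> 0" for x
  proof -
    have "x \<in> Units (ring_of_type_algebra \<lparr>carrier := K\<rparr>)"
      using that subfield_Units by (auto simp: ring_of_type_algebra_def)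
    thus ?thesis by (auto simp: Units_def ring_of_type_algebra_def)
  qed
qed

text \<open>The nonzero elements of \<open>K\<close> satisfy \<open>x ^ (q - 1) = 1\<close>, by the
  product over \<open>K - {0}\<close>, and \<open>X ^ q - X\<close> has at most \<open>q\<close>
  roots, so \<open>K\<close> is its full root set. Membership in \<open>K\<close> becomes an
  equation that power identities can check.\<close>

lemma mem_K_iff: "x \<in> K \<longleftrightarrow> x ^ q = x"
proof -
  have "x ^ q = x" if xK: "x \<in> K" for x
  proof (cases "x = 0")
    case False
    obtain y where y: "y \<in> K" "x * y = 1" using subfield_facts(4)[OF xK False] by blast
    hence y0: "y \<noteq> 0" by auto
    have "(\<Prod>z\<in>K - {0}. x * z) = x ^ (q - 1) * \<Prod>(K - {0})"
      using subfield_facts(1) by (simp add: prod.distrib card_K)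
    moreover have "(\<Prod>z\<in>K - {0}. x * z) = \<Prod>(K - {0})"
      by (rule prod.reindex_bij_witness[of _ "\<lambda>z. y * z" "\<lambda>z. x * z"])
         (use False y y0 xK in \<open>auto simp: subfield_facts mult.assoc[symmetric] mult.commute[of y x]\<close>)
    ultimately have "x ^ (q - 1) = 1" by simp
    hence "x ^ Suc (q - 1) = x" by simp
    thus ?thesis using q_ge_2 by simp
  qed (use q_ge_2 in auto)
  hence sub: "K \<subseteq> {x. x ^ q = x}" by blast
  let ?P = "Polynomial.monom 1 q - Polynomial.monom 1 1 :: 'a Polynomial.poly"
  have coeff: "Polynomial.coeff ?P q = 1" using q_ge_2 by simp
  hence P0: "?P \<noteq> 0" by (metis coeff_0 zero_neq_one)
  have "card {x :: 'a. x ^ q = x} = card {x. Polynomial.poly ?P x = 0}"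
    by (simp add: poly_monom)
  also have "\<dots> \<le> Polynomial.degree ?P" using P0 by (rule card_poly_roots_bound)
  also have "\<dots> \<le> q" using q_ge_2 by (intro degree_diff_le) (auto intro: order_trans[OF degree_monom_le])
  finally have "K = {x. x ^ q = x}"
    using sub card_K by (intro card_seteq) auto
  thus ?thesis by blast
qed

lemma norm_in_K [simp]: "N x \<in> K"
proof (cases "x = 0")
  case False
  have "N x ^ q = x ^ (\<nu> * (Suc (q - 1)))" using q_ge_2 by (simp add: field_norm_eq flip: power_mult)
  also have "\<dots> = x ^ (card (UNIV :: 'a set) - 1) * x ^ \<nu>"
    using \<nu>_mult by (simp add: power_add mult.commute)
  also have "\<dots> = N x" using nonzero_power_card_minus_1[OF False] by (simp add: field_norm_eq)
  finally show ?thesis by (simp add: mem_K_iff)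
qed (simp add: subfield_facts)

lemma K_divide: "x \<in> K \<Longrightarrow> y \<in> K \<Longrightarrow> x / y \<in> K"
  by (simp add: mem_K_iff power_divide)

lemma K_mult: "x \<in> K \<Longrightarrow> y \<in> K \<Longrightarrow> x * y \<in> K"
  by (simp add: mem_K_iff power_mult_distrib)

lemma K_power: "x \<in> K \<Longrightarrow> x ^ i \<in> K"
  by (metis mem_K_iff mult.commute power_mult)

text \<open>A unit \<open>w ^ i\<close> lies in \<open>K\<close> only if
  \<open>w ^ (i * (q - 1)) = 1\<close>, that is, if \<open>\<nu>\<close> divides \<open>i\<close>;
  so the norm of a generator of the field generates the units of \<open>K\<close>. Surjectivity of
  the norm is a corollary.\<close>

lemma generator_of_norms:
  fixes w :: 'a
  assumes w: "w \<noteq> 0" "\<And>x. x \<noteq> 0 \<Longrightarrow> \<exists>i < card (UNIV :: 'a set) - 1. x = w ^ i" "\<And>i. w ^ i = 1 \<longleftrightarrow> (card (UNIV :: 'a set) - 1) dvd i"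
    and x: "x \<in> K" "x \<noteq> 0"
  shows "\<exists>i < q - 1. x = N w ^ i"
proof -
  obtain i where i: "i < card (UNIV :: 'a set) - 1" "x = w ^ i" using w(2)[OF x(2)] by blast
  have "x * x ^ (q - 1) = x ^ Suc (q - 1)" by simp
  also have "\<dots> = x" using x q_ge_2 by (simp add: mem_K_iff)
  finally have "x ^ (q - 1) = 1" using x by simp
  hence "w ^ (i * (q - 1)) = 1" by (simp only: i power_mult)
  hence "(q - 1) * \<nu> dvd (q - 1) * i" by (simp only: w(3) \<nu>_mult mult.commute)
  hence "\<nu> dvd i" using q_ge_2 by simp
  then obtain j where j: "i = \<nu> * j" by (elim dvdE)
  hence "\<nu> * j < \<nu> * (q - 1)" using i \<nu>_mult by (simp add: mult.commute)
  hence "j < q - 1" by simp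
  moreover have "x = N w ^ j" by (simp add: i j field_norm_eq power_mult)
  ultimately show ?thesis by blast
qed

lemma norm_surj: "x \<in> K \<Longrightarrow> \<exists>y. N y = x"
proof (cases "x = 0")
  case False
  assume "x \<in> K"
  obtain w :: 'a where "w \<noteq> 0" "\<And>x. x \<noteq> 0 \<Longrightarrow> \<exists>i < card (UNIV :: 'a set) - 1. x = w ^ i" "\<And>i. w ^ i = 1 \<longleftrightarrow> (card (UNIV :: 'a set) - 1) dvd i"
    by (rule finite_field_generator) (rule that)
  from generator_of_norms[OF this \<open>x \<in> K\<close> False] show ?thesis
    by (metis norm_power)
qed (use norm_0 in blast)

lemma V_iff: "(A, a) \<in> V \<longleftrightarrow> a \<in> K \<and> a \<noteq> 0"
  by (auto simp: NG_verts_def)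

lemma E_iff: "E (A, a) (B, b) \<longleftrightarrow> N (A + B) = a * b"
  by (simp add: NG_adj_def)

section \<open>Common neighbours and the coordinates\<close>

lemma card_norm_fibre:
  assumes "c \<in> K" "c \<noteq> 0"
  shows "card {Y. N Y = c} = card {Y. N Y = 1}"
proof -
  obtain C where C: "N C = c" using norm_surj assms by blast
  hence "C \<noteq> 0" using assms by auto
  have "bij_betw (\<lambda>Y. C * Y) {Y. N Y = 1} {Y. N Y = c}"
    by (rule bij_betw_byWitness[where f' = "\<lambda>Y. Y / C"])
       (use C \<open>C \<noteq> 0\<close> assms in \<open>auto simp: norm_mult norm_divide\<close>)
  thus ?thesis by (simp add: bij_betw_same_card)
qed

text \<open>Loops count: \<open>w\<close> may be \<open>u\<close> or \<open>v\<close>.\<close>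

definition codegree :: "'a \<times> 'a \<Rightarrow> 'a \<times> 'a \<Rightarrow> nat" where
  "codegree u v = card {w \<in> V. E u w \<and> E v w}"

lemma codegree_same_fst:
  assumes "(A, a) \<in> V" "(A, b) \<in> V" "a \<noteq> b"
  shows "codegree (A, a) (A, b) = 0"
proof -
  have "\<not> (E (A, a) w \<and> E (A, b) w)" if "w \<in> V" for w
    using assms that by (cases w) (auto simp: E_iff V_iff)
  thus ?thesis by (simp add: codegree_def)
qed

text \<open>Dividing the two adjacency conditions for \<open>(Z, x)\<close> removes \<open>x\<close>
  and leaves \<open>Y = (A + Z) / (B + Z)\<close> with norm \<open>a / b\<close>. This Moebius map
  in \<open>Z\<close> misses only the value 1, which has norm 1 and so reduces the count exactly
  when \<open>a = b\<close>.\<close>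

lemma codegree_different_fst:
  assumes "(A, a) \<in> V" "(B, b) \<in> V" "A \<noteq> B"
  shows "codegree (A, a) (B, b) = card {Y. N Y = 1} - (if a = b then 1 else 0)"
proof -
  have ab: "a \<in> K" "b \<in> K" "a \<noteq> 0" "b \<noteq> 0" using assms by (auto simp: V_iff)
  let ?W = "{w \<in> V. E (A, a) w \<and> E (B, b) w}"
  have "bij_betw (\<lambda>(Z, x). (A + Z) / (B + Z)) ?W ({Y. N Y = a / b} - {1})"
  proof (rule bij_betw_byWitness[where f' = "\<lambda>Y. ((B * Y - A) / (1 - Y), N ((B - A) / (1 - Y)) / b)"])
    show "\<forall>w\<in>?W. (\<lambda>Y. ((B * Y - A) / (1 - Y), N ((B - A) / (1 - Y)) / b)) ((\<lambda>(Z, x). (A + Z) / (B + Z)) w) = w"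
    proof
      fix w assume "w \<in> ?W"
      then obtain Z x where w: "w = (Z, x)" "x \<noteq> 0" "N (A + Z) = a * x" "N (B + Z) = b * x"
        by (cases w) (auto simp: V_iff E_iff)
      hence BZ: "B + Z \<noteq> 0" using ab by auto
      define Y where "Y = (A + Z) / (B + Z)"
      have Y: "1 - Y = (B - A) / (B + Z)" using BZ by (simp add: Y_def field_simps)
      have "1 - Y \<noteq> 0" using Y BZ assms by simp
      have "B * Y - A = Z * (1 - Y)" using BZ by (simp add: Y_def field_simps)
      hence "(B * Y - A) / (1 - Y) = Z" using \<open>1 - Y \<noteq> 0\<close> by simp
      moreover have "(B - A) / (1 - Y) = B + Z" using Y BZ assms by simp
      ultimately show "(\<lambda>Y. ((B * Y - A) / (1 - Y), N ((B - A) / (1 - Y)) / b)) ((\<lambda>(Z, x). (A + Z) / (B + Z)) w) = w"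
        using w ab by (simp add: Y_def[symmetric])
    qed
    have *: "A + (B * Y - A) / (1 - Y) = Y * ((B - A) / (1 - Y))"
      "B + (B * Y - A) / (1 - Y) = (B - A) / (1 - Y)" if "Y \<noteq> 1" for Y
      using that by (auto simp: field_simps)
    show "\<forall>Y\<in>{Y. N Y = a / b} - {1}. (\<lambda>(Z, x). (A + Z) / (B + Z)) ((B * Y - A) / (1 - Y), N ((B - A) / (1 - Y)) / b) = Y"
      using assms by (auto simp: *)
    show "(\<lambda>(Z, x). (A + Z) / (B + Z)) ` ?W \<subseteq> {Y. N Y = a / b} - {1}"
      using ab assms by (auto simp: V_iff E_iff norm_divide)
    show "(\<lambda>Y. ((B * Y - A) / (1 - Y), N ((B - A) / (1 - Y)) / b)) ` ({Y. N Y = a / b} - {1}) \<subseteq> ?W"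
      using ab assms by (auto simp: V_iff E_iff * norm_mult norm_divide intro!: K_divide K_mult)
  qed
  hence "codegree (A, a) (B, b) = card ({Y. N Y = a / b} - {1})"
    unfolding codegree_def by (rule bij_betw_same_card)
  also have "\<dots> = card {Y. N Y = a / b} - (if a = b then 1 else 0)"
    using ab by (auto simp: card_Diff_singleton)
  finally show ?thesis using card_norm_fibre[of "a / b"] ab by (simp add: K_divide)
qed

lemma automorphism_facts:
  assumes "f \<in> graph_automorphisms V E"
  shows "bij_betw f V V" "\<And>u. u \<in> V \<Longrightarrow> f u \<in> V"
    and "\<And>u v. u \<in> V \<Longrightarrow> v \<in> V \<Longrightarrow> E (f u) (f v) \<longleftrightarrow> E u v"
    and "\<And>u v. u \<in> V \<Longrightarrow> v \<in> V \<Longrightarrow> f u = f v \<longleftrightarrow> u = v"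
  using assms by (auto simp: graph_automorphisms_def Bij_def bij_betw_def inj_on_eq_iff)

lemma card_preserved:
  assumes f: "f \<in> graph_automorphisms V E"
    and P: "\<And>w. w \<in> V \<Longrightarrow> P' (f w) \<longleftrightarrow> P w"
  shows "card {w \<in> V. P' w} = card {w \<in> V. P w}"
proof -
  have "f ` {w \<in> V. P w} = {w \<in> V. P' w}"
  proof (intro equalityI subsetI)
    fix w assume w: "w \<in> {w \<in> V. P' w}"
    moreover have "f ` V = V" using automorphism_facts(1)[OF f] by (simp add: bij_betw_def)
    ultimately obtain v where "v \<in> V" "w = f v" by blast
    thus "w \<in> f ` {w \<in> V. P w}" using w P by blast
  qed (use P automorphism_facts(2)[OF f] in auto)
  moreover have "inj_on f {w \<in> V. P w}"
    using automorphism_facts(1)[OF f] by (auto simp: bij_betw_def intro: inj_on_subset)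
  ultimately show ?thesis by (metis card_image)
qed

lemma codegree_preserved:
  assumes "f \<in> graph_automorphisms V E" "u \<in> V" "v \<in> V"
  shows "codegree (f u) (f v) = codegree u v"
  unfolding codegree_def
  by (rule card_preserved[OF assms(1)]) (use automorphism_facts[OF assms(1)] assms in auto)

lemma card_norm_kernel:
  assumes "t > 2" shows "card {Y. N Y = 1} \<ge> 2"
proof -
  have "\<not> inj_on N (UNIV - {0})"
  proof
    assume "inj_on N (UNIV - {0})"
    hence "card (UNIV - {0 :: 'a}) \<le> card (K - {0})"
      by (rule card_inj_on_le) auto
    hence "q ^ (t - 1) - 1 \<le> q - 1" by (simp add: card_UNIV card_K subfield_facts)
    moreover have "q ^ 1 < q ^ (t - 1)" using assms q_ge_2 by (intro power_strict_increasing) auto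
    ultimately show False using q_ge_2 by simp
  qed
  then obtain x y where "x \<noteq> 0" "y \<noteq> 0" "N x = N y" "x \<noteq> y"
    unfolding inj_on_def by blast
  hence "{1, x / y} \<subseteq> {Y. N Y = 1}" "1 \<noteq> x / y"
    by (auto simp: norm_divide)
  thus ?thesis using card_mono[of "{Y. N Y = 1}" "{1, x / y}"] by simp
qed

text \<open>For \<open>t > 2\<close> the codegree alone tells the three possible positions of two vertices apart.
  For \<open>t = 2\<close> the norm is the identity and the codegree vanishes whenever a coordinate
  is shared; then the number \<open>z\<close> of vertices in codegree zero with both, which is \<open>q - 3\<close> or
  \<open>q - 2\<close>, decides which one is.\<close>
lemma automorphism_preserves_coordinates:
  assumes f: "f \<in> graph_automorphisms V E" and q2: "q > 2"
    and u: "u \<in> V" and v: "v \<in> V"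
  shows "fst u = fst v \<Longrightarrow> fst (f u) = fst (f v)" and "snd u = snd v \<Longrightarrow> snd (f u) = snd (f v)"
proof -
  note fV = automorphism_facts(2)[OF f] and finj = automorphism_facts(4)[OF f]
  define \<kappa> where "\<kappa> = card {Y. N Y = 1}"
  have cd1: "codegree u v = 0" if "u \<in> V" "v \<in> V" "u \<noteq> v" "fst u = fst v" for u v
    using that codegree_same_fst by (cases u; cases v) auto
  have cd2: "codegree u v = \<kappa> - (if snd u = snd v then 1 else 0)" if "u \<in> V" "v \<in> V" "fst u \<noteq> fst v" for u v
    using that codegree_different_fst unfolding \<kappa>_def by (cases u; cases v) auto
  have "(u \<noteq> v \<longrightarrow> fst u = fst v \<longrightarrow> fst (f u) = fst (f v)) \<and>
        (u \<noteq> v \<longrightarrow> snd u = snd v \<longrightarrow> snd (f u) = snd (f v))"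
  proof (cases "t > 2")
    case True
    hence \<kappa>: "\<kappa> \<ge> 2" unfolding \<kappa>_def by (rule card_norm_kernel)
    have 1: "fst u = fst v \<longleftrightarrow> codegree u v = 0" if "u \<in> V" "v \<in> V" "u \<noteq> v" for u v
      using that cd1[of u v] cd2[of u v] \<kappa> by (cases "fst u = fst v") (auto split: if_splits)
    have 2: "snd u = snd v \<longleftrightarrow> codegree u v = \<kappa> - 1" if "u \<in> V" "v \<in> V" "u \<noteq> v" for u v
    proof (cases "fst u = fst v")
      case True
      hence "snd u \<noteq> snd v" using that by (auto simp: prod_eq_iff)
      thus ?thesis using cd1[of u v] that True \<kappa> by simp
    next
      case False
      thus ?thesis using cd2[of u v] that \<kappa> by auto
    qed
    show ?thesis
      using u v 1[of u v] 2[of u v] 1[of "f u" "f v"] 2[of "f u" "f v"] fV finj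
        codegree_preserved[OF f u v] by auto
  next
    case False
    hence t2: "t = 2" using t by simp
    have N_id: "N x = x" for x unfolding field_norm_eq by (simp add: t2)
    have \<kappa>: "\<kappa> = 1" by (simp add: \<kappa>_def N_id)
    \<comment> \<open>On the grid of vertices this relation joins distinct points of a common line;
      lines of one kind have \<open>q\<close> points, those of the other \<open>q - 1\<close>. For
      such \<open>u\<close> and \<open>v\<close>, \<open>z\<close> counts the further points on
      their line.\<close>
    define Z where "Z u v \<longleftrightarrow> u \<noteq> v \<and> codegree u v = 0" for u v
    have Z: "Z u v \<longleftrightarrow> u \<noteq> v \<and> (fst u = fst v \<or> snd u = snd v)" if "u \<in> V" "v \<in> V" for u v
      using cd1[of u v] cd2[of u v] that
      by (cases "fst u = fst v") (auto simp: Z_def \<kappa> split: if_splits)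
    define z where "z u v = card {w \<in> V. Z u w \<and> Z v w}" for u v
    have z_fst: "z u v = q - 3" if "u \<in> V" "v \<in> V" "u \<noteq> v" "fst u = fst v" for u v
    proof -
      have "snd u \<noteq> snd v" using that by (auto simp: prod_eq_iff)
      hence "{w \<in> V. Z u w \<and> Z v w} = {fst u} \<times> (K - {0, snd u, snd v})"
        using that by (auto simp: Z NG_verts_def)
      moreover have "card (K - {0, snd u, snd v}) = q - 3"
        using that \<open>snd u \<noteq> snd v\<close> subfield_facts(1)
        by (subst card_Diff_subset) (auto simp: NG_verts_def card_K)
      ultimately show ?thesis by (simp add: z_def card_cartesian_product)
    qed
    have z_snd: "z u v = q - 2" if "u \<in> V" "v \<in> V" "u \<noteq> v" "snd u = snd v" for u v
    proof -
      have "fst u \<noteq> fst v" using that by (auto simp: prod_eq_iff)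
      hence "{w \<in> V. Z u w \<and> Z v w} = (UNIV - {fst u, fst v}) \<times> {snd u}"
        using that by (auto simp: Z NG_verts_def)
      moreover have "card (UNIV - {fst u, fst v}) = q - 2"
        using \<open>fst u \<noteq> fst v\<close> by (subst card_Diff_subset) (auto simp: card_UNIV t2)
      ultimately show ?thesis by (simp add: z_def card_cartesian_product)
    qed
    have Z_pres: "Z (f u) (f v) \<longleftrightarrow> Z u v" if "u \<in> V" "v \<in> V" for u v
      using that codegree_preserved[OF f] finj by (simp add: Z_def)
    have z_pres: "z (f u) (f v) = z u v"
      unfolding z_def by (rule card_preserved[OF f]) (simp add: Z_pres u v)
    have diff: "q - 3 \<noteq> q - 2" using q2 by simp
    show ?thesis
      using Z[OF u v] Z[OF fV[OF u] fV[OF v]] Z_pres[OF u v] z_pres diff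
        z_fst[OF u v] z_snd[OF u v] z_fst[OF fV[OF u] fV[OF v]] z_snd[OF fV[OF u] fV[OF v]]
      by metis
  qed
  thus "fst u = fst v \<Longrightarrow> fst (f u) = fst (f v)" "snd u = snd v \<Longrightarrow> snd (f u) = snd (f v)"
    by (cases "u = v"; simp)+
qed

section \<open>From automorphisms to maps of the field\<close>

lemma automorphism_is_product:
  assumes f: "f \<in> graph_automorphisms V E" and q2: "q > 2"
  obtains F G where "bij F" "inj_on G (K - {0})" "G ` (K - {0}) = K - {0}"
    "\<And>A a. a \<in> K - {0} \<Longrightarrow> f (A, a) = (F A, G a)"
proof -
  define F where "F A = fst (f (A, 1))" for A
  define G where "G a = snd (f (0, a))" for a
  have 1: "1 \<in> K - {0}" using subfield_facts by simp
  have V: "(A, a) \<in> V" if "a \<in> K - {0}" for A a using that by (simp add: V_iff)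
  have eq: "f (A, a) = (F A, G a)" if a: "a \<in> K - {0}" for A a
    using automorphism_preserves_coordinates(1)[OF f q2 V[OF a, of A] V[OF 1, of A]]
      automorphism_preserves_coordinates(2)[OF f q2 V[OF a, of A] V[OF a, of 0]]
    by (simp add: F_def G_def prod_eq_iff)
  have inj: "f u = f v \<longleftrightarrow> u = v" if "u \<in> V" "v \<in> V" for u v
    using automorphism_facts(4)[OF f that] .
  have "inj F"
  proof (rule injI)
    fix A B assume "F A = F B"
    hence "f (A, 1) = f (B, 1)" using eq[OF 1] by simp
    thus "A = B" using inj[OF V[OF 1] V[OF 1]] by simp
  qed
  hence F: "bij F" by (simp add: bij_def finite_UNIV_inj_surj)
  have G_inj: "inj_on G (K - {0})"
  proof (rule inj_onI)
    fix a b assume ab: "a \<in> K - {0}" "b \<in> K - {0}" "G a = G b"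
    hence "f (0, a) = f (0, b)" using eq by simp
    thus "a = b" using inj[OF V[OF ab(1)] V[OF ab(2)]] by simp
  qed
  have "G ` (K - {0}) \<subseteq> K - {0}"
  proof
    fix b assume "b \<in> G ` (K - {0})"
    then obtain a where a: "a \<in> K - {0}" "b = G a" by blast
    have "f (0, a) \<in> V" using automorphism_facts(2)[OF f V[OF a(1)]] .
    thus "b \<in> K - {0}" using a eq[OF a(1), of 0] by (simp add: V_iff)
  qed
  hence G_img: "G ` (K - {0}) = K - {0}" using G_inj by (intro endo_inj_surj) auto
  show ?thesis by (rule that[OF F G_inj G_img eq])
qed

lemma automorphism_classification:
  assumes f: "f \<in> graph_automorphisms V E" and q2: "q > 2"
  obtains D A c i where "D \<noteq> 0" "c \<in> K" "c ^ 2 = N D" "i < k * (t - 1)" "A + A = 0"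
    "\<And>Y y. y \<in> K - {0} \<Longrightarrow> f (Y, y) = (D * Y ^ (p ^ i) + A, c * y ^ (p ^ i))"
proof -
  obtain F G where F: "bij F" and G: "inj_on G (K - {0})" "G ` (K - {0}) = K - {0}"
    and eq: "\<And>A a. a \<in> K - {0} \<Longrightarrow> f (A, a) = (F A, G a)"
    by (rule automorphism_is_product[OF f q2]) (rule that)
  have K1: "1 \<in> K - {0}" using subfield_facts by simp
  have Gc: "G a \<in> K - {0}" if "a \<in> K - {0}" for a using that G by blast
  have adj: "N (F A + F B) = G a * G b \<longleftrightarrow> N (A + B) = a * b" if "a \<in> K - {0}" "b \<in> K - {0}" for A B a b
    using automorphism_facts(3)[OF f, of "(A, a)" "(B, b)"] that eq by (simp add: V_iff E_iff)
  define c where "c = G 1"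
  have c: "c \<in> K - {0}" using Gc[OF K1] by (simp add: c_def)
  \<comment> \<open>One \<open>A\<close> of norm \<open>a * b\<close> witnesses adjacency of
    \<open>(A, a)\<close> with \<open>(0, b)\<close> and of \<open>(A, 1)\<close> with
    \<open>(0, a * b)\<close>; after applying \<open>f\<close>, both evaluate
    \<open>N (F A + F 0)\<close>.\<close>
  have G_mult: "G a * G b = c * G (a * b)" if ab: "a \<in> K - {0}" "b \<in> K - {0}" for a b
  proof -
    have K: "a * b \<in> K - {0}" using ab by (simp add: K_mult)
    obtain A where "N A = a * b" using norm_surj K by blast
    thus ?thesis using adj[OF ab, of A 0] adj[OF K1 K, of A 0] by (simp add: c_def)
  qed
  obtain w :: 'a where w: "w \<noteq> 0" "\<And>x. x \<noteq> 0 \<Longrightarrow> \<exists>i < card (UNIV :: 'a set) - 1. x = w ^ i"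
    "\<And>i. w ^ i = 1 \<longleftrightarrow> (card (UNIV :: 'a set) - 1) dvd i"
    by (rule finite_field_generator) (rule that)
  define \<gamma> where "\<gamma> = N w"
  have \<gamma>: "\<gamma> \<in> K - {0}" using w by (simp add: \<gamma>_def)
  have \<gamma>_gen: "\<exists>i < q - 1. x = \<gamma> ^ i" if "x \<in> K - {0}" for x
    using generator_of_norms[OF w] that unfolding \<gamma>_def by blast
  \<comment> \<open>Relative to \<open>c = G 1\<close> the map \<open>G\<close> is an endomorphism
    of the cyclic group of units of \<open>K\<close>, hence a power map; its exponent is read off at
    the generator \<open>\<gamma>\<close>.\<close>
  obtain e where e: "e < q - 1" "G \<gamma> / c = \<gamma> ^ e"
    using \<gamma>_gen[of "G \<gamma> / c"] Gc[OF \<gamma>] c by (auto simp: K_divide)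
  have G_pow: "G (\<gamma> ^ i) = c * (\<gamma> ^ i) ^ e" for i
  proof (induction i)
    case (Suc i)
    have "c * G (\<gamma> ^ Suc i) = G \<gamma> * G (\<gamma> ^ i)"
      using G_mult[OF \<gamma>, of "\<gamma> ^ i"] \<gamma> by (simp add: K_power)
    also have "\<dots> = c * (c * (\<gamma> ^ Suc i) ^ e)"
      using e c Suc by (simp add: field_simps power_mult_distrib)
    finally show ?case using c by simp
  qed (simp add: c_def)
  have G_eq: "G x = c * x ^ e" if x: "x \<in> K - {0}" for x
    using \<gamma>_gen[OF x] G_pow by auto
  have "e \<noteq> 0"
  proof
    assume "e = 0"
    hence "G \<gamma> = G 1" using G_eq[OF \<gamma>] G_eq[OF K1] by simp
    hence "\<gamma> = 1" using G(1) \<gamma> K1 by (auto dest: inj_onD)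
    hence "K - {0} \<subseteq> {1}" using \<gamma>_gen by fastforce
    hence "card (K - {0}) \<le> card {1 :: 'a}" by (intro card_mono) auto
    thus False using q2 by (simp add: card_K subfield_facts)
  qed
  have zero: "F A + F (- A) = 0" for A
  proof (rule ccontr)
    assume *: "F A + F (- A) \<noteq> 0"
    define z where "z = N (F A + F (- A))"
    have "z / c \<in> K - {0}" using * c by (simp add: z_def K_divide)
    then obtain y where y: "y \<in> K - {0}" "z / c = G y" using G(2) by blast
    hence "N (F A + F (- A)) = G 1 * G y" using c by (simp add: z_def[symmetric] c_def[symmetric] field_simps)
    thus False using adj[OF K1 y(1), of A "- A"] y by simp
  qed
  have norm_diff: "N (F A - F B) = c ^ 2 * N (A - B) ^ e" for A B
  proof (cases "A = B")
    case True
    thus ?thesis using \<open>e \<noteq> 0\<close> by simp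
  next
    case False
    hence z: "N (A - B) \<in> K - {0}" by simp
    have FB: "F A - F B = F A + F (- B)" using zero[of B] by (simp add: algebra_simps eq_neg_iff_add_eq_0)
    have "N (F A - F B) = G 1 * G (N (A - B))"
      unfolding FB using adj[OF K1 z, of A "- B"] by simp
    thus ?thesis by (simp only: G_eq[OF z] c_def[symmetric] power2_eq_square mult.assoc)
  qed
  define D where "D = F 1 - F 0"
  have "F 1 \<noteq> F 0" using F by (metis bij_is_inj injD zero_neq_one)
  hence D: "D \<noteq> 0" by (simp add: D_def)
  have ND: "c ^ 2 = N D" using norm_diff[of 1 0] by (simp add: D_def)
  define h where "h A = (F A - F 0) / D" for A
  have "inj h" using F D by (auto simp: h_def bij_def inj_def)
  hence "bij h" by (simp add: bij_def finite_UNIV_inj_surj)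
  moreover have Nh: "N (h A - h B) = N (A - B) ^ e" for A B
  proof -
    have "h A - h B = (F A - F B) / D" by (simp add: h_def diff_divide_distrib)
    thus ?thesis using norm_diff[of A B] ND D by (simp add: norm_divide)
  qed
  hence "(h A - h B) ^ \<nu> = (A - B) ^ (\<nu> * e)" for A B
    by (simp add: field_norm_eq power_mult)
  moreover have "h 0 = 0" "h 1 = 1" using D by (simp_all add: h_def D_def)
  ultimately have "\<exists>i < k * (t - 1). \<forall>x. h x = x ^ (p ^ i)"
    using norm_semi_isometry_is_Frobenius_power[OF prime_char _ k q2 _ card_UNIV, of h e] t q e CHAR_eq by simp
  then obtain i where i: "i < k * (t - 1)" "\<And>x. h x = x ^ (p ^ i)" by blast
  have F_eq: "F Y = D * Y ^ (p ^ i) + F 0" for Y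
    using i(2)[of Y] D by (simp add: h_def field_simps)
  \<comment> \<open>On the units of \<open>K\<close> the exponents \<open>e\<close> and
    \<open>p ^ i\<close> act alike: write \<open>y\<close> as a norm and compute
    \<open>N (h Y)\<close> in two ways.\<close>
  have G_Frob: "G y = c * y ^ (p ^ i)" if y: "y \<in> K - {0}" for y
  proof -
    obtain Y where Y: "N Y = y" using norm_surj y by blast
    have "y ^ e = N (h Y - h 0)" using Nh[of Y 0] Y by simp
    also have "\<dots> = y ^ (p ^ i)" using Y \<open>h 0 = 0\<close> by (simp add: i(2)[of Y] norm_power)
    finally show ?thesis using G_eq[OF y] by simp
  qed
  have f_eq: "f (Y, y) = (D * Y ^ (p ^ i) + F 0, c * y ^ (p ^ i))" if "y \<in> K - {0}" for Y y
    unfolding eq[OF that] G_Frob[OF that] prod.inject by (rule conjI[OF F_eq refl])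
  have "F 0 + F 0 = 0" using zero[of 0] by simp
  thus ?thesis using that[OF D _ ND i(1) _ f_eq] c by blast
qed

end

section \<open>The automorphism group\<close>

text \<open>The additive group of the field in coordinates over the prime field. Basis elements are
  chosen greedily: integer combinations of \<open>n < m\<close> elements take at most
  \<open>CHAR('a) ^ n\<close> values, so some \<open>c\<close> is missed, and adjoining it preserves
  independence. After \<open>m\<close> steps counting makes \<open>L\<close> bijective.\<close>

lemma prime_field_coordinates:
  assumes p: "Factorial_Ring.prime CHAR('a::{field,finite})" and card: "card (UNIV :: 'a set) = CHAR('a) ^ m"
  obtains L :: "(nat \<Rightarrow> int) \<Rightarrow> 'a::{field,finite}" where
    "bij_betw L (\<Pi>\<^sub>E i\<in>{..<m}. {0..<int CHAR('a)}) UNIV"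
    "\<And>u v. L (\<lambda>i\<in>{..<m}. (u i + v i) mod int CHAR('a)) = L u + L v"
proof -
  let ?p = "CHAR('a)"
  have p0: "?p > 0" using p by (rule prime_gt_0_nat)
  have of_int_mod: "of_int (x mod int ?p) = (of_int x :: 'a)" for x
  proof -
    have "(of_int x :: 'a) = of_int (int ?p * (x div int ?p) + x mod int ?p)" by simp
    thus ?thesis by (simp only: of_int_add of_int_mult of_int_of_nat_eq of_nat_CHAR) simp
  qed
  define L where "L b n u = (\<Sum>i<n. of_int (u i) * b i)" for b :: "nat \<Rightarrow> 'a" and n and u :: "nat \<Rightarrow> int"
  let ?P = "\<lambda>n :: nat. \<Pi>\<^sub>E i\<in>{..<n}. {0..<int ?p}"
  have finP: "finite (?P n)" for n by (intro finite_PiE) auto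
  have cardP: "card (?P n) = ?p ^ n" for n by (simp add: card_PiE)
  have "\<exists>b. \<forall>u. L b n u = 0 \<longrightarrow> (\<forall>i<n. int ?p dvd u i)" if "n \<le> m" for n
    using that
  proof (induction n)
    case (Suc n)
    then obtain b where b: "\<And>u. L b n u = 0 \<Longrightarrow> \<forall>i<n. int ?p dvd u i" by auto
    have "card (L b n ` ?P n) \<le> ?p ^ n" using card_image_le[OF finP] by (simp add: cardP)
    also have "\<dots> < card (UNIV :: 'a set)"
      unfolding card using Suc.prems prime_gt_1_nat[OF p] by (intro power_strict_increasing) auto
    finally have "L b n ` ?P n \<noteq> UNIV" by auto
    then obtain c where c: "c \<notin> L b n ` ?P n" by blast
    have c': "c \<noteq> L b n u" for u
    proof -
      have "L b n u = L b n (\<lambda>i\<in>{..<n}. u i mod int ?p)"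
        by (simp add: L_def of_int_mod)
      moreover have "(\<lambda>i\<in>{..<n}. u i mod int ?p) \<in> ?P n" using p0 by auto
      ultimately show ?thesis using c by auto
    qed
    define b' where "b' = b(n := c)"
    have L': "L b' (Suc n) u = L b n u + of_int (u n) * c" for u
      by (simp add: L_def b'_def)
    have "\<forall>i<Suc n. int ?p dvd u i" if "L b' (Suc n) u = 0" for u
    proof -
      \<comment> \<open>Otherwise \<open>u n\<close> is invertible modulo \<open>?p\<close>, and
        solving the relation for \<open>c\<close> would express it through the earlier
        elements.\<close>
      have "int ?p dvd u n"
      proof (rule ccontr)
        assume "\<not> int ?p dvd u n"
        hence "coprime (u n) (int ?p)"
          using p prime_imp_coprime[of "int ?p" "u n"] by (simp add: coprime_commute)
        then obtain x y where xy: "x * u n + y * int ?p = 1"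
          using bezout_int[of "u n" "int ?p"] by (auto simp: coprime_iff_gcd_eq_1)
        hence "of_int (x * u n + y * int ?p) = (1 :: 'a)" by simp
        hence x: "of_int x * of_int (u n) = (1 :: 'a)" by simp
        have "c = (of_int x * of_int (u n)) * c" by (simp add: x)
        also have "\<dots> = of_int x * (of_int (u n) * c)" by simp
        also have "of_int (u n) * c = - L b n u" using that by (simp add: L' eq_neg_iff_add_eq_0 add.commute)
        also have "of_int x * - L b n u = L b n (\<lambda>i. - x * u i)"
          by (simp add: L_def sum_distrib_left sum_negf mult.assoc)
        finally show False using c' by blast
      qed
      moreover from this have "(of_int (u n) :: 'a) = 0"
        using of_int_mod[of "u n"] by (simp add: mod_eq_0_iff_dvd)
      hence "L b n u = 0" using that by (simp add: L')
      hence "\<forall>i<n. int ?p dvd u i" by (rule b)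
      ultimately show ?thesis by (simp add: less_Suc_eq)
    qed
    thus ?case by blast
  qed simp
  then obtain b where b: "\<And>u. L b m u = 0 \<Longrightarrow> \<forall>i<m. int ?p dvd u i" by blast
  have inj: "inj_on (L b m) (?P m)"
  proof (rule inj_onI)
    fix u v assume uv: "u \<in> ?P m" "v \<in> ?P m" "L b m u = L b m v"
    have "L b m (\<lambda>i. u i - v i) = 0"
      using uv by (simp add: L_def sum_subtractf algebra_simps)
    hence dvd: "\<forall>i<m. int ?p dvd u i - v i" using b by blast
    show "u = v"
    proof (rule PiE_ext[OF uv(1,2)])
      fix i assume i: "i \<in> {..<m}"
      hence "u i \<in> {0..<int ?p}" "v i \<in> {0..<int ?p}" using uv by (auto simp: PiE_iff)
      moreover have "u i mod int ?p = v i mod int ?p" using dvd i by (simp add: mod_eq_dvd_iff)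
      ultimately show "u i = v i" by simp
    qed
  qed
  have "L b m ` ?P m = UNIV"
    using card_image[OF inj] by (intro card_subset_eq) (auto simp: cardP card)
  hence bij: "bij_betw (L b m) (?P m) UNIV" using inj by (simp add: bij_betw_def)
  have add: "L b m (\<lambda>i\<in>{..<m}. (u i + v i) mod int ?p) = L b m u + L b m v" for u v
    by (simp add: L_def of_int_mod sum.distrib algebra_simps)
  show ?thesis using bij add by (rule that[of "L b m"])
qed

text \<open>Only the difference of the exponents must be below the order; this suits exponents such
  as \<open>p ^ i\<close>, which are bounded by the field size.\<close>

lemma power_eq_imp_eq_below_order:
  fixes x :: "'b::field"
  assumes order: "\<And>i. x ^ i = 1 \<longleftrightarrow> h dvd i" and "x \<noteq> 0" "x ^ i = x ^ j" "i < j + h" "j < i + h"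
  shows "i = j"
proof -
  have *: "i = j" if "i \<le> j" "x ^ i = x ^ j" "j < i + h" for i j
  proof -
    have "x ^ i * x ^ (j - i) = x ^ j"
      by (simp only: power_add[symmetric] le_add_diff_inverse[OF that(1)])
    hence "x ^ i * x ^ (j - i) = x ^ i * 1" using that(2) by simp
    hence "h dvd j - i" using \<open>x \<noteq> 0\<close> by (simp add: order)
    moreover have "j - i < h" using that by simp
    ultimately have "j - i = 0" by (metis dvd_imp_le not_less neq0_conv)
    thus ?thesis using that by simp
  qed
  show ?thesis
  proof (cases "i \<le> j")
    case True
    thus ?thesis by (rule *[OF _ assms(3,5)])
  next
    case False
    hence "j \<le> i" by simp
    from *[OF this assms(3)[symmetric] assms(4)] show ?thesis ..
  qed
qed

lemma group_graph_Aut: "group (graph_Aut W R)"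
proof -
  have "subgroup (graph_automorphisms W R) (BijGroup W)"
  proof (rule group.subgroupI[OF group_BijGroup])
    show "graph_automorphisms W R \<subseteq> carrier (BijGroup W)"
      by (auto simp: graph_automorphisms_def BijGroup_def)
    show "graph_automorphisms W R \<noteq> {}"
    proof -
      have "(\<lambda>x\<in>W. x) \<in> graph_automorphisms W R"
        using id_Bij[of W] by (simp add: graph_automorphisms_def)
      thus ?thesis by blast
    qed
  next
    fix f assume f: "f \<in> graph_automorphisms W R"
    hence fB: "f \<in> Bij W" by (simp add: graph_automorphisms_def)
    have "R u v \<longleftrightarrow> R (inv_into W f u) (inv_into W f v)" if "u \<in> W" "v \<in> W" for u v
    proof -
      have "f (inv_into W f u) = u" "f (inv_into W f v) = v"
        using fB that by (auto simp: Bij_def bij_betw_def f_inv_into_f)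
      moreover have "inv_into W f u \<in> W" "inv_into W f v \<in> W"
        using Bij_inv_into_mem[OF fB] that by simp_all
      ultimately show ?thesis using f by (auto simp: graph_automorphisms_def)
    qed
    thus "inv\<^bsub>BijGroup W\<^esub> f \<in> graph_automorphisms W R"
      using restrict_inv_into_Bij[OF fB] by (simp add: inv_BijGroup[OF fB] graph_automorphisms_def)
  next
    fix f g assume fg: "f \<in> graph_automorphisms W R" "g \<in> graph_automorphisms W R"
    hence B: "f \<in> Bij W" "g \<in> Bij W" by (simp_all add: graph_automorphisms_def)
    have "g u \<in> W" if "u \<in> W" for u using funcset_mem[OF Bij_imp_funcset[OF B(2)] that] .
    thus "f \<otimes>\<^bsub>BijGroup W\<^esub> g \<in> graph_automorphisms W R"
      using fg B by (simp add: BijGroup_def graph_automorphisms_def compose_Bij) (simp add: compose_def)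
  qed
  thus ?thesis
    unfolding graph_Aut_def by (rule subgroup.subgroup_is_group[OF _ group_BijGroup])
qed

lemma mult_graph_Aut:
  assumes "f \<in> graph_automorphisms W R" "g \<in> graph_automorphisms W R"
  shows "f \<otimes>\<^bsub>graph_Aut W R\<^esub> g = compose W f g"
proof -
  have "f \<in> Bij W" "g \<in> Bij W" using assms unfolding graph_automorphisms_def by blast+
  thus ?thesis by (simp add: graph_Aut_def BijGroup_def)
qed

section \<open>Semilinear automorphisms and their composition\<close>

context projective_norm_graph
begin

lemma Frobenius_add: "(x + y :: 'a) ^ (p ^ i) = x ^ (p ^ i) + y ^ (p ^ i)"
  using prime_char by (intro freshmans_dream') (simp_all add: CHAR_eq)

lemma Frobenius_inj: "x ^ (p ^ i) = y ^ (p ^ i) \<longleftrightarrow> x = (y :: 'a)"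
proof
  assume "x ^ (p ^ i) = y ^ (p ^ i)"
  hence "(x - y) ^ (p ^ i) = 0" using Frobenius_diff[OF prime_char, of x y i] by (simp add: CHAR_eq)
  thus "x = y" by simp
qed simp

abbreviation "m \<equiv> k * (t - 1)"
abbreviation "G \<equiv> graph_Aut V E"

lemma m_pos: "m > 0" using k t by simp

text \<open>With \<open>D\<close> and \<open>c\<close> as separate parameters, each of
  \<open>D\<close>, \<open>c\<close>, \<open>A\<close> is determined by the map, and for nonzero
  \<open>D\<close> so is \<open>i\<close> modulo \<open>m\<close>; the \<open>C\<close> of the
  theorem enters through \<open>D = C ^ 2\<close>.\<close>

definition semilinear_map :: "'a \<Rightarrow> nat \<Rightarrow> 'a \<Rightarrow> 'a \<Rightarrow> 'a \<times> 'a \<Rightarrow> 'a \<times> 'a" where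
  "semilinear_map D i c A = restrict (\<lambda>(Y, y). (D * Y ^ (p ^ i) + A, c * y ^ (p ^ i))) V"

text \<open>The condition \<open>A + A = 0\<close> says \<open>A = 0\<close> in odd characteristic and is vacuous in even
  characteristic.\<close>
definition admissible :: "'a \<Rightarrow> 'a \<Rightarrow> 'a \<Rightarrow> bool" where
  "admissible D c A \<longleftrightarrow> D \<noteq> 0 \<and> c \<in> K \<and> c ^ 2 = N D \<and> A + A = 0"

lemma admissible_nonzero: "admissible D c A \<Longrightarrow> c \<noteq> 0"
  by (auto simp: admissible_def)

lemma semilinear_map_apply:
  "(Y, y) \<in> V \<Longrightarrow> semilinear_map D i c A (Y, y) = (D * Y ^ (p ^ i) + A, c * y ^ (p ^ i))"
  by (simp add: semilinear_map_def)

lemma semilinear_map_automorphism: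
  assumes "admissible D c A"
  shows "semilinear_map D i c A \<in> graph_automorphisms V E"
proof -
  let ?f = "semilinear_map D i c A"
  have c: "D \<noteq> 0" "c \<noteq> 0" "c \<in> K" "N D = c ^ 2"
    using assms admissible_nonzero[OF assms] by (simp_all add: admissible_def)
  have A: "A + A = 0" using assms by (simp add: admissible_def)
  have into: "?f ` V \<subseteq> V"
    using c by (auto simp: semilinear_map_def V_iff K_mult K_power)
  have inj: "inj_on ?f V"
    using c by (auto intro!: inj_onI simp: semilinear_map_def Frobenius_inj)
  have "finite V" by (rule finite_subset[OF subset_UNIV]) simp
  hence "bij_betw ?f V V"
    using into inj endo_inj_surj[of V ?f] by (simp add: bij_betw_def)
  moreover have "E u v \<longleftrightarrow> E (?f u) (?f v)" if "u \<in> V" "v \<in> V" for u v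
  proof -
    obtain Y y Z z where [simp]: "u = (Y, y)" "v = (Z, z)" by (cases u; cases v)
    \<comment> \<open>The translation enters an adjacency condition twice, so its contribution is
      \<open>A + A\<close>.\<close>
    have "(D * Y ^ (p ^ i) + A) + (D * Z ^ (p ^ i) + A) = D * (Y + Z) ^ (p ^ i) + (A + A)"
      by (simp add: Frobenius_add algebra_simps)
    hence "N ((D * Y ^ (p ^ i) + A) + (D * Z ^ (p ^ i) + A)) = c ^ 2 * N (Y + Z) ^ (p ^ i)"
      using c by (simp add: A norm_mult norm_power)
    hence "E (?f u) (?f v) \<longleftrightarrow> c ^ 2 * N (Y + Z) ^ (p ^ i) = c ^ 2 * (y * z) ^ (p ^ i)"
      using that by (simp add: semilinear_map_apply E_iff power2_eq_square power_mult_distrib mult_ac)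
    thus ?thesis using c by (simp add: E_iff Frobenius_inj)
  qed
  moreover have "?f \<in> extensional V" by (simp add: semilinear_map_def)
  ultimately show ?thesis
    unfolding graph_automorphisms_def Bij_def by blast
qed

lemma semilinear_map_mod: "semilinear_map D (i mod m) c A = semilinear_map D i c A"
  using Frobenius_power_mod[OF Q_eq] by (simp add: semilinear_map_def)

lemma semilinear_map_compose:
  assumes "admissible D' c' A'"
  shows "compose V (semilinear_map D i c A) (semilinear_map D' j c' A') =
    semilinear_map (D * D' ^ (p ^ i)) (i + j) (c * c' ^ (p ^ i)) (D * A' ^ (p ^ i) + A)"
proof
  fix u
  show "compose V (semilinear_map D i c A) (semilinear_map D' j c' A') u =
    semilinear_map (D * D' ^ (p ^ i)) (i + j) (c * c' ^ (p ^ i)) (D * A' ^ (p ^ i) + A) u"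
  proof (cases "u \<in> V")
    case True
    obtain Y y where [simp]: "u = (Y, y)" by (cases u)
    have "semilinear_map D' j c' A' u \<in> V"
      using automorphism_facts(2)[OF semilinear_map_automorphism[OF assms] True] .
    thus ?thesis using True
      by (simp add: compose_def semilinear_map_apply Frobenius_add power_mult_distrib power_add
            algebra_simps flip: power_mult)
  next
    case False
    thus ?thesis by (simp add: compose_def semilinear_map_def)
  qed
qed

lemma semilinear_map_eqD:
  assumes "semilinear_map D i c A = semilinear_map D' j c' A'"
  shows "A = A'" "D = D'" "c = c'" "D \<noteq> 0 \<Longrightarrow> i < m \<Longrightarrow> j < m \<Longrightarrow> i = j"
proof -
  have V1: "(Y, 1) \<in> V" for Y by (simp add: V_iff subfield_facts)
  have eq: "(D * Y ^ (p ^ i) + A, c) = (D' * Y ^ (p ^ j) + A', c')" for Y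
    using fun_cong[OF assms, of "(Y, 1)"] V1 by (simp add: semilinear_map_apply)
  have p0: "p > 0" using prime_gt_0_nat[OF prime_p] .
  show A: "A = A'" using eq[of 0] p0 by (simp add: zero_power)
  show D: "D = D'" using eq[of 1] A by simp
  show "c = c'" using eq[of 0] by simp
  show "i = j" if "D \<noteq> 0" "i < m" "j < m"
  proof -
    obtain w :: 'a where w: "w \<noteq> 0" "\<And>i. w ^ i = 1 \<longleftrightarrow> (card (UNIV :: 'a set) - 1) dvd i"
      by (rule finite_field_generator) (rule that)
    have p1: "p > 1" using prime_gt_1_nat[OF prime_p] .
    have weq: "w ^ (p ^ i) = w ^ (p ^ j)" using eq[of w] A D that by simp
    have "0 < p ^ l" "p ^ l < card (UNIV :: 'a set)" if "l < m" for l
      unfolding Q_eq using that p1 by simp_all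
    from this[OF that(2)] this[OF that(3)]
    have "p ^ i < p ^ j + (card (UNIV :: 'a set) - 1)" "p ^ j < p ^ i + (card (UNIV :: 'a set) - 1)"
      by linarith+
    hence "p ^ i = p ^ j" by (rule power_eq_imp_eq_below_order[OF w(2,1) weq])
    thus ?thesis using p1 by simp
  qed
qed

lemma automorphisms_eq_semilinear_maps:
  assumes "q > 2"
  shows "graph_automorphisms V E = {semilinear_map D i c A | D i c A. admissible D c A \<and> i < m}"
proof (intro equalityI subsetI)
  fix f assume f: "f \<in> graph_automorphisms V E"
  obtain D A c i where *: "D \<noteq> 0" "c \<in> K" "c ^ 2 = N D" "i < m" "A + A = 0"
    "\<And>Y y. y \<in> K - {0} \<Longrightarrow> f (Y, y) = (D * Y ^ (p ^ i) + A, c * y ^ (p ^ i))"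
    by (rule automorphism_classification[OF f assms]) (rule that)
  have ext: "f \<in> extensional V" using f unfolding graph_automorphisms_def Bij_def by blast
  have "f = semilinear_map D i c A"
  proof (rule extensionalityI[OF ext])
    fix u assume "u \<in> V"
    thus "f u = semilinear_map D i c A u"
      by (cases u) (simp add: semilinear_map_apply *(6) V_iff)
  qed (simp add: semilinear_map_def)
  thus "f \<in> {semilinear_map D i c A | D i c A. admissible D c A \<and> i < m}"
    using * unfolding admissible_def by blast
qed (use semilinear_map_automorphism in auto)

end

lemma power_nat_mod_add:
  fixes x :: "'b::monoid_mult"
  assumes "x ^ h = 1" "h > 0" "0 \<le> a" "0 \<le> b"
  shows "x ^ nat ((a + b) mod int h) = x ^ nat a * x ^ nat b"
proof -
  have "nat ((a + b) mod int h) = (nat a + nat b) mod h"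
    using assms by (simp add: nat_mod_distrib nat_add_distrib)
  thus ?thesis by (simp only: power_mod_eq[OF assms(1)] power_add)
qed

context projective_norm_graph
begin

lemma mult_semilinear_maps:
  assumes "admissible D c A" "admissible D' c' A'"
  shows "semilinear_map D i c A \<otimes>\<^bsub>G\<^esub> semilinear_map D' j c' A' =
    semilinear_map (D * D' ^ (p ^ i)) (i + j) (c * c' ^ (p ^ i)) (D * A' ^ (p ^ i) + A)"
  using assms by (simp add: mult_graph_Aut semilinear_map_automorphism semilinear_map_compose)

lemma carrier_G: "carrier G = graph_automorphisms V E"
  by (simp add: graph_Aut_def)

lemma one_G: "\<one>\<^bsub>G\<^esub> = semilinear_map 1 0 1 0"
  by (auto simp: graph_Aut_def BijGroup_def semilinear_map_def fun_eq_iff)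

lemma admissible_1: "A + A = 0 \<Longrightarrow> admissible 1 1 A"
  by (simp add: admissible_def subfield_facts)

lemma admissible_square: "C \<noteq> 0 \<Longrightarrow> s \<in> K \<Longrightarrow> s ^ 2 = 1 \<Longrightarrow> A + A = 0 \<Longrightarrow> admissible (C ^ 2) (s * N C) A"
  by (simp add: admissible_def K_mult norm_power power_mult_distrib)

lemma admissible_Frobenius:
  assumes "admissible D c A"
  shows "admissible (D ^ (p ^ i)) (c ^ (p ^ i)) (A ^ (p ^ i))"
proof -
  have "A ^ (p ^ i) + A ^ (p ^ i) = (A + A) ^ (p ^ i)" by (rule Frobenius_add[symmetric])
  also have "A + A = 0" using assms by (simp add: admissible_def)
  also have "0 ^ (p ^ i) = (0 :: 'a)" using prime_gt_0_nat[OF prime_p] by (simp add: zero_power)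
  finally have "A ^ (p ^ i) + A ^ (p ^ i) = 0" .
  moreover have "(c ^ (p ^ i)) ^ 2 = (c ^ 2) ^ (p ^ i)"
    by (simp only: power_mult[symmetric] mult.commute)
  ultimately show ?thesis
    using assms by (simp add: admissible_def K_power norm_power)
qed

lemma pow_semilinear_map:
  assumes "admissible D c 0"
  shows "semilinear_map D 0 c 0 [^]\<^bsub>G\<^esub> (i :: nat) = semilinear_map (D ^ i) 0 (c ^ i) 0"
    and "semilinear_map 1 1 1 0 [^]\<^bsub>G\<^esub> (i :: nat) = semilinear_map 1 i 1 0"
proof -
  interpret group G by (rule group_graph_Aut)
  have adm: "admissible (D ^ i) (c ^ i) 0" for i
  proof -
    have "(c ^ i) ^ 2 = (c ^ 2) ^ i" by (simp only: power_mult[symmetric] mult.commute)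
    thus ?thesis using assms by (simp add: admissible_def K_power norm_power)
  qed
  show "semilinear_map D 0 c 0 [^]\<^bsub>G\<^esub> i = semilinear_map (D ^ i) 0 (c ^ i) 0"
    by (induction i) (simp_all add: one_G mult_semilinear_maps adm assms mult.commute)
  show "semilinear_map 1 1 1 0 [^]\<^bsub>G\<^esub> i = semilinear_map 1 i 1 0"
    using prime_gt_0_nat[OF prime_p]
    by (induction i) (simp_all add: one_G mult_semilinear_maps admissible_1 zero_power)
qed

text \<open>This isolates what the three cases share: the maps with \<open>i = 0\<close> form the
  normal factor, and the coordinatewise Frobenius generates a complement of order \<open>m\<close>.
  It remains to identify the normal factor \<open>H\<close> in each case.\<close>

lemma graph_Aut_semidirect:
  assumes q2: "q > 2" and hom: "\<eta> \<in> hom H G" and inj: "inj_on \<eta> (carrier H)"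
    and closed: "\<And>u v. u \<in> carrier H \<Longrightarrow> v \<in> carrier H \<Longrightarrow> u \<otimes>\<^bsub>H\<^esub> v \<in> carrier H"
    and img: "\<eta> ` carrier H = {semilinear_map D 0 c A | D c A. admissible D c A}"
  shows "\<exists>\<phi> \<in> hom (integer_mod_group m) (AutoGroup H). G \<cong> semidirect_product H (integer_mod_group m) \<phi>"
proof -
  have grp: "group G" by (rule group_graph_Aut)
  let ?\<sigma> = "semilinear_map 1 1 1 0"
  have adm1: "admissible 1 1 0" by (rule admissible_1) simp
  have pow: "?\<sigma> [^]\<^bsub>G\<^esub> (i :: nat) = semilinear_map 1 i 1 0" for i
    using pow_semilinear_map(2)[OF adm1] .
  have \<sigma>: "?\<sigma> \<in> carrier G" using semilinear_map_automorphism[OF adm1] by (simp add: carrier_G)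
  have \<sigma>m: "?\<sigma> [^]\<^bsub>G\<^esub> m = \<one>\<^bsub>G\<^esub>"
    unfolding pow one_G using semilinear_map_mod[of 1 m 1 0] by simp
  have form: "\<exists>D c A. admissible D c A \<and> \<eta> u = semilinear_map D 0 c A" if "u \<in> carrier H" for u
    using img that by blast
  have rform: "\<exists>u \<in> carrier H. \<eta> u = semilinear_map D 0 c A" if "admissible D c A" for D c A
  proof -
    have "semilinear_map D 0 c A \<in> \<eta> ` carrier H" unfolding img using that by blast
    thus ?thesis by auto
  qed
  have prod: "semilinear_map D 0 c A \<otimes>\<^bsub>G\<^esub> ?\<sigma> [^]\<^bsub>G\<^esub> i = semilinear_map D i c A" if "admissible D c A" for D c A i
    unfolding pow using mult_semilinear_maps[OF that admissible_1, of 0 0 i] by simp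
  have conj: "\<exists>v\<in>carrier H. ?\<sigma> \<otimes>\<^bsub>G\<^esub> \<eta> u = \<eta> v \<otimes>\<^bsub>G\<^esub> ?\<sigma>" if u: "u \<in> carrier H" for u
  proof -
    obtain D c A where D: "admissible D c A" "\<eta> u = semilinear_map D 0 c A" using form[OF u] by blast
    note D' = admissible_Frobenius[OF D(1), of 1]
    obtain v where v: "v \<in> carrier H" "\<eta> v = semilinear_map (D ^ (p ^ 1)) 0 (c ^ (p ^ 1)) (A ^ (p ^ 1))"
      using rform[OF D'] by blast
    have "?\<sigma> \<otimes>\<^bsub>G\<^esub> \<eta> u = \<eta> v \<otimes>\<^bsub>G\<^esub> ?\<sigma>"
      unfolding D(2) v(2) mult_semilinear_maps[OF adm1 D(1)] mult_semilinear_maps[OF D' adm1] by simp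
    thus ?thesis using v by blast
  qed
  have uniq: "i = j" if u: "u \<in> carrier H" and v: "v \<in> carrier H" and "i < m" "j < m"
    "\<eta> u \<otimes>\<^bsub>G\<^esub> ?\<sigma> [^]\<^bsub>G\<^esub> i = \<eta> v \<otimes>\<^bsub>G\<^esub> ?\<sigma> [^]\<^bsub>G\<^esub> j" for u v i j
  proof -
    obtain D c A where D: "admissible D c A" "\<eta> u = semilinear_map D 0 c A" using form[OF u] by blast
    obtain D' c' A' where D': "admissible D' c' A'" "\<eta> v = semilinear_map D' 0 c' A'" using form[OF v] by blast
    have "semilinear_map D i c A = semilinear_map D' j c' A'"
      using that(5) unfolding D(2) D'(2) prod[OF D(1)] prod[OF D'(1)] .
    moreover have "D \<noteq> 0" using D by (simp add: admissible_def)
    ultimately show ?thesis using semilinear_map_eqD(4) that(3,4) by blast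
  qed
  obtain \<phi> \<Theta> where \<phi>: "\<phi> \<in> hom (integer_mod_group m) (AutoGroup H)"
    and \<Theta>: "\<Theta> \<in> hom (semidirect_product H (integer_mod_group m) \<phi>) G"
      "inj_on \<Theta> (carrier (semidirect_product H (integer_mod_group m) \<phi>))"
      "\<Theta> ` carrier (semidirect_product H (integer_mod_group m) \<phi>) =
        {\<eta> u \<otimes>\<^bsub>G\<^esub> ?\<sigma> [^]\<^bsub>G\<^esub> i | u i. u \<in> carrier H \<and> i < m}"
      "\<And>x y. x \<in> carrier (semidirect_product H (integer_mod_group m) \<phi>) \<Longrightarrow>
        y \<in> carrier (semidirect_product H (integer_mod_group m) \<phi>) \<Longrightarrow>
        x \<otimes>\<^bsub>semidirect_product H (integer_mod_group m) \<phi>\<^esub> y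
          \<in> carrier (semidirect_product H (integer_mod_group m) \<phi>)"
    by (rule semidirect_product_cyclic_embedding[OF grp m_pos hom inj _ \<sigma> \<sigma>m])
       (rule closed, assumption+, rule conj, assumption, rule uniq, assumption+, rule that, assumption+)
  have "{\<eta> u \<otimes>\<^bsub>G\<^esub> ?\<sigma> [^]\<^bsub>G\<^esub> i | u i. u \<in> carrier H \<and> i < m} = carrier G"
    unfolding carrier_G automorphisms_eq_semilinear_maps[OF q2]
  proof (intro equalityI subsetI)
    fix g assume "g \<in> {\<eta> u \<otimes>\<^bsub>G\<^esub> ?\<sigma> [^]\<^bsub>G\<^esub> i | u i. u \<in> carrier H \<and> i < m}"
    then obtain u i where u: "g = \<eta> u \<otimes>\<^bsub>G\<^esub> ?\<sigma> [^]\<^bsub>G\<^esub> i" "u \<in> carrier H" "i < m" by blast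
    obtain D c A where D: "admissible D c A" "\<eta> u = semilinear_map D 0 c A" using form u by blast
    thus "g \<in> {semilinear_map D i c A | D i c A. admissible D c A \<and> i < m}"
      using u prod[OF D(1)] by auto
  next
    fix g assume "g \<in> {semilinear_map D i c A | D i c A. admissible D c A \<and> i < m}"
    then obtain D i c A where D: "g = semilinear_map D i c A" "admissible D c A" "i < m" by blast
    obtain u where "u \<in> carrier H" "\<eta> u = semilinear_map D 0 c A" using rform[OF D(2)] by blast
    thus "g \<in> {\<eta> u \<otimes>\<^bsub>G\<^esub> ?\<sigma> [^]\<^bsub>G\<^esub> i | u i. u \<in> carrier H \<and> i < m}"
      using D prod[OF D(2)] by (metis (mono_tags, lifting) mem_Collect_eq)
  qed
  thus ?thesis using iso_sym_of_closed[OF \<Theta>(1,2) _ \<Theta>(4)] \<Theta>(3) \<phi> by blast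
qed

section \<open>Admissible parameters in odd and even characteristic\<close>

lemma odd_characteristic:
  assumes "odd q"
  shows "p \<noteq> 2" "(2 :: 'a) \<noteq> 0" "(-1 :: 'a) \<in> K" "odd (card (UNIV :: 'a set))" "N (-1) = (-1) ^ (t - 1)"
proof -
  show p: "p \<noteq> 2" using assms q k by auto
  show "(2 :: 'a) \<noteq> 0"
  proof
    assume "(2 :: 'a) = 0"
    hence "p dvd 2" using of_nat_eq_0_iff_char_dvd[where ?'a = 'a, of 2] by (simp add: CHAR_eq)
    thus False using p prime_p primes_dvd_imp_eq two_is_prime_nat by blast
  qed
  show "(-1 :: 'a) \<in> K" using assms by (simp add: mem_K_iff)
  show "odd (card (UNIV :: 'a set))" using assms by (simp add: card_UNIV)
  \<comment> \<open>The exponent \<open>\<nu>\<close> is a sum of \<open>t - 1\<close> odd numbers,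
    so the parity of \<open>t - 1\<close> decides whether \<open>-1\<close> has norm
    \<open>-1\<close> or 1; this separates the two groups for odd \<open>q\<close>.\<close>
  have "even (\<Sum>j<n. q ^ j) \<longleftrightarrow> even n" for n using assms by (induction n) auto
  thus "N (-1) = (-1) ^ (t - 1)"
    unfolding field_norm_eq by (cases "even (t - 1)") simp_all
qed

lemma even_characteristic:
  assumes "even q"
  shows "p = 2" "x + x = (0 :: 'a)" "even (card (UNIV :: 'a set))"
proof -
  show p: "p = 2" using assms prime_p unfolding q
    by (metis even_power primes_dvd_imp_eq two_is_prime_nat)
  have "of_nat 2 = (0 :: 'a)" using of_nat_CHAR[where ?'a = 'a] unfolding CHAR_eq p .
  thus "x + x = 0" by (metis mult_2 mult_zero_left of_nat_numeral)
  show "even (card (UNIV :: 'a set))" using assms t by (simp add: card_UNIV)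
qed

text \<open>With \<open>q - 1 = 2 * r\<close>, the equation \<open>N D = c ^ 2\<close> gives
  \<open>N D ^ r = c ^ (q - 1) = 1\<close>. For \<open>D = w ^ d\<close> the order
  \<open>2 * r * \<nu>\<close> of \<open>w\<close> then divides \<open>d * \<nu> * r\<close>, so
  \<open>d\<close> is even and \<open>D\<close> is a square. The sign is the ambiguity in extracting
  \<open>c\<close> from \<open>c ^ 2 = N C ^ 2\<close>.\<close>

lemma admissible_odd_cases:
  assumes "odd q" "admissible D c A"
  obtains C s where "C \<noteq> 0" "s \<in> {1, -1}" "D = C ^ 2" "c = s * N C" "A = 0"
proof -
  have D: "D \<noteq> 0" "c \<in> K" "c \<noteq> 0" "c ^ 2 = N D" "A + A = 0"
    using assms admissible_nonzero[OF assms(2)] by (simp_all add: admissible_def)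
  have A: "A = 0" using D(5) odd_characteristic(2)[OF assms(1)] by (metis mult_2 mult_eq_0_iff)
  obtain w :: 'a where w: "w \<noteq> 0" "\<And>x. x \<noteq> 0 \<Longrightarrow> \<exists>i < card (UNIV :: 'a set) - 1. x = w ^ i"
    "\<And>i. w ^ i = 1 \<longleftrightarrow> (card (UNIV :: 'a set) - 1) dvd i"
    by (rule finite_field_generator) (rule that)
  obtain d where d: "D = w ^ d" using w D by blast
  obtain r where "q = 2 * r + 1" using assms(1) by (elim oddE)
  hence r: "q - 1 = 2 * r" by simp
  have r0: "r > 0" using r q_ge_2 by simp
  have "c * c ^ (q - 1) = c ^ Suc (q - 1)" by simp
  also have "\<dots> = c" using D q_ge_2 by (simp add: mem_K_iff)
  finally have "c ^ (q - 1) = 1" using D by simp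
  hence "N D ^ r = 1" unfolding r by (simp add: power_mult D)
  hence "w ^ (d * (\<nu> * r)) = 1" by (simp add: d field_norm_eq mult.assoc flip: power_mult)
  hence "2 * r * \<nu> dvd d * (\<nu> * r)" unfolding w(3) \<nu>_mult[symmetric] r .
  hence "(r * \<nu>) * 2 dvd (r * \<nu>) * d" by (simp add: mult_ac)
  hence "r * \<nu> = 0 \<or> 2 dvd d" by (simp only: nat_mult_dvd_cancel_disj)
  moreover have "r * \<nu> \<noteq> 0" using r0 \<nu>_pos by (metis mult_is_0 not_gr_zero)
  ultimately obtain i where i: "d = i * 2" by (metis dvdE mult.commute)
  define C where "C = w ^ i"
  have C: "D = C ^ 2" "C \<noteq> 0" using w by (simp_all add: d i C_def power_mult)
  have "c ^ 2 = N C ^ 2" using D C by (simp add: norm_power)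
  hence "c = N C \<or> c = - N C" by (simp add: power2_eq_iff)
  thus ?thesis using that[of C 1] that[of C "-1"] C A by auto
qed

text \<open>Every element is a square, a root of \<open>D\<close> being \<open>D\<close> to half the
  field size; \<open>c\<close> is then the norm of that root because squaring is injective.\<close>

lemma admissible_even_cases:
  assumes "even q" "admissible D c A"
  obtains C where "C \<noteq> 0" "D = C ^ 2" "c = N C"
proof -
  have D: "D \<noteq> 0" "c ^ 2 = N D"
    using assms by (simp_all add: admissible_def)
  obtain r where r: "card (UNIV :: 'a set) = r * 2" using even_characteristic(3)[OF assms(1)] by (metis evenE mult.commute)
  define C where "C = D ^ r"
  have C: "D = C ^ 2" using power_card_UNIV[of D] by (simp add: C_def r power_mult)
  hence C0: "C \<noteq> 0" using D by auto
  have "c ^ (p ^ 1) = N C ^ (p ^ 1)" using D C by (simp add: norm_power even_characteristic(1)[OF assms(1)])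
  hence "c = N C" by (simp only: Frobenius_inj)
  thus ?thesis using that C C0 by blast
qed

lemma generator:
  obtains w :: 'a where "w \<noteq> 0" "\<And>x. x \<noteq> 0 \<Longrightarrow> \<exists>i < q ^ (t - 1) - 1. x = w ^ i"
    "\<And>i. w ^ i = 1 \<longleftrightarrow> (q ^ (t - 1) - 1) dvd i"
  by (rule finite_field_generator[where ?'a = 'a, unfolded card_UNIV]) (rule that)

lemma NG_map_odd_eq: "NG_map_odd p q t K C i s = semilinear_map (C ^ 2) i (s * N C) 0"
  by (simp add: NG_map_odd_def semilinear_map_def)

lemma NG_map_even_eq: "NG_map_even p q t K C A i = semilinear_map (C ^ 2) i (N C) A"
  by (simp add: NG_map_even_def semilinear_map_def)

lemma admissible_signed_square:
  assumes "odd q" "s \<in> {1, -1}" "C \<noteq> 0" shows "admissible (C ^ 2) (s * N C) 0"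
  using assms odd_characteristic(3)[OF assms(1)] by (intro admissible_square) (auto simp: subfield_facts)

lemma admissible_square_even:
  assumes "even q" "C \<noteq> 0" shows "admissible (C ^ 2) (N C) A"
  using admissible_square[OF assms(2), of 1 A] even_characteristic(2)[OF assms(1)] by (simp add: subfield_facts)

lemma NG_map_odd_automorphism:
  assumes "odd q" "s \<in> {1, -1}" "C \<noteq> 0"
  shows "NG_map_odd p q t K C i s \<in> graph_automorphisms V E"
  unfolding NG_map_odd_eq by (intro semilinear_map_automorphism admissible_signed_square assms)

lemma NG_map_even_automorphism:
  assumes "even q" "C \<noteq> 0"
  shows "NG_map_even p q t K C A i \<in> graph_automorphisms V E"
  unfolding NG_map_even_eq by (intro semilinear_map_automorphism admissible_square_even assms)

text \<open>The classification has \<open>0 \<le> i < m\<close> while the theorem counts from 1;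
  residue 0 is represented by \<open>m\<close>, a trivial Frobenius power.\<close>

lemma exponent_in_range: "\<exists>j \<in> {1..m}. \<forall>D c A. semilinear_map D j c A = semilinear_map D i c A"
proof (cases "i mod m = 0")
  case True
  have "semilinear_map D m c A = semilinear_map D i c A" for D c A
    using semilinear_map_mod[of D m c A] semilinear_map_mod[of D i c A] True by simp
  thus ?thesis using m_pos by (intro bexI[of _ m]) auto
next
  case False
  have "i mod m < m" using m_pos by simp
  thus ?thesis using False by (intro bexI[of _ "i mod m"] allI semilinear_map_mod) simp
qed

lemma automorphisms_odd:
  assumes "q > 2" "odd q"
  shows "graph_automorphisms V E = {NG_map_odd p q t K C i s | C i s. C \<noteq> 0 \<and> i \<in> {1..m} \<and> s \<in> {1, -1}}"
proof (intro equalityI subsetI)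
  fix f assume "f \<in> graph_automorphisms V E"
  then obtain D i c A where f: "f = semilinear_map D i c A" "admissible D c A"
    unfolding automorphisms_eq_semilinear_maps[OF assms(1)] by blast
  obtain C s where C: "C \<noteq> 0" "s \<in> {1, -1}" "D = C ^ 2" "c = s * N C" "A = 0"
    by (rule admissible_odd_cases[OF assms(2) f(2)]) (rule that)
  obtain j where j: "j \<in> {1..m}" "\<forall>D c A. semilinear_map D j c A = semilinear_map D i c A"
    using exponent_in_range by blast
  have "f = NG_map_odd p q t K C j s" using f C j by (simp add: NG_map_odd_eq)
  thus "f \<in> {NG_map_odd p q t K C i s | C i s. C \<noteq> 0 \<and> i \<in> {1..m} \<and> s \<in> {1, -1}}"
    using C(1,2) j(1) by blast
qed (use NG_map_odd_automorphism[OF assms(2)] in blast)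

lemma automorphisms_even:
  assumes "q > 2" "even q"
  shows "graph_automorphisms V E = {NG_map_even p q t K C A i | C A i. C \<noteq> 0 \<and> i \<in> {1..m}}"
proof (intro equalityI subsetI)
  fix f assume "f \<in> graph_automorphisms V E"
  then obtain D i c A where f: "f = semilinear_map D i c A" "admissible D c A"
    unfolding automorphisms_eq_semilinear_maps[OF assms(1)] by blast
  obtain C where C: "C \<noteq> 0" "D = C ^ 2" "c = N C"
    by (rule admissible_even_cases[OF assms(2) f(2)]) (rule that)
  obtain j where j: "j \<in> {1..m}" "\<forall>D c A. semilinear_map D j c A = semilinear_map D i c A"
    using exponent_in_range by blast
  have "f = NG_map_even p q t K C A j" using f C j by (simp add: NG_map_even_eq)
  thus "f \<in> {NG_map_even p q t K C A i | C A i. C \<noteq> 0 \<and> i \<in> {1..m}}"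
    using C(1) j(1) by blast
qed (use NG_map_even_automorphism[OF assms(2)] in blast)

section \<open>The three isomorphism types\<close>

lemma graph_Aut_odd_odd:
  assumes q2: "q > 2" and odd: "odd q" "odd (t - 1)"
  shows "\<exists>\<phi> \<in> hom (integer_mod_group m) (AutoGroup (integer_mod_group (q ^ (t - 1) - 1))).
    G \<cong> semidirect_product (integer_mod_group (q ^ (t - 1) - 1)) (integer_mod_group m) \<phi>"
proof -
  define h where "h = q ^ (t - 1) - 1"
  have h: "h > 0" using card_UNIV_ge_2[where ?'a = 'a] by (simp add: h_def card_UNIV)
  obtain w :: 'a where w: "w \<noteq> 0" "\<And>x. x \<noteq> 0 \<Longrightarrow> \<exists>i < h. x = w ^ i" "\<And>i. w ^ i = 1 \<longleftrightarrow> h dvd i"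
    by (rule generator[folded h_def]) (rule that)
  \<comment> \<open>For odd \<open>t - 1\<close> a unit \<open>C\<close> is determined by
    \<open>(C ^ 2, N C)\<close>, as \<open>N (- C) = - N C\<close>, so the units of the field
    themselves form the normal factor.\<close>
  define \<eta> where "\<eta> a = semilinear_map ((w ^ nat a) ^ 2) 0 (N (w ^ nat a)) 0" for a
  have adm: "admissible (C ^ 2) (N C) 0" if "C \<noteq> 0" for C
    using admissible_signed_square[OF odd(1) _ that, of 1] by simp
  have car: "carrier (integer_mod_group h) = {0..<int h}"
    using h by (simp only: carrier_integer_mod_group) simp
  have add: "w ^ nat ((a + b) mod int h) = w ^ nat a * w ^ nat b" if "0 \<le> a" "0 \<le> b" for a b
    using w(3)[of h] by (intro power_nat_mod_add h that) simp
  show ?thesis unfolding h_def[symmetric]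
  proof (rule graph_Aut_semidirect[OF q2])
    show "\<eta> \<in> hom (integer_mod_group h) G"
    proof (rule homI)
      fix a show "\<eta> a \<in> carrier G"
        using semilinear_map_automorphism[OF adm] w by (simp add: \<eta>_def carrier_G)
    next
      fix a b assume "a \<in> carrier (integer_mod_group h)" "b \<in> carrier (integer_mod_group h)"
      hence ab: "0 \<le> a" "0 \<le> b" unfolding car by auto
      show "\<eta> (a \<otimes>\<^bsub>integer_mod_group h\<^esub> b) = \<eta> a \<otimes>\<^bsub>G\<^esub> \<eta> b"
        using w unfolding \<eta>_def mult_integer_mod_group add[OF ab]
        by (simp add: mult_semilinear_maps adm norm_mult power_mult_distrib)
    qed
    show "inj_on \<eta> (carrier (integer_mod_group h))"
    proof (rule inj_onI)
      fix a b assume ab: "a \<in> carrier (integer_mod_group h)" "b \<in> carrier (integer_mod_group h)" "\<eta> a = \<eta> b"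
      define x y where "x = w ^ nat a" and "y = w ^ nat b"
      have xy: "x ^ 2 = y ^ 2" "N x = N y" "y \<noteq> 0"
        using semilinear_map_eqD(2,3)[OF ab(3)[unfolded \<eta>_def]] w by (simp_all add: x_def y_def)
      have "x \<noteq> - y"
      proof
        assume "x = - y"
        hence "N x = N ((-1) * y)" by simp
        also have "\<dots> = - N y" using odd odd_characteristic(5) by (simp only: norm_mult) simp
        finally have "N y = - N y" unfolding xy(2) .
        hence "2 * N y = 0" by (simp only: eq_neg_iff_add_eq_0 mult_2)
        thus False using xy(3) odd_characteristic(2)[OF odd(1)] by simp
      qed
      hence "w ^ nat a = w ^ nat b" using xy by (auto simp: power2_eq_iff x_def y_def)
      moreover have "0 \<le> a" "0 \<le> b" "nat a < h" "nat b < h" using ab unfolding car by auto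
      ultimately show "a = b"
        using power_eq_imp_eq_below_order[OF w(3,1), of "nat a" "nat b"] by simp
    qed
    show "u \<otimes>\<^bsub>integer_mod_group h\<^esub> v \<in> carrier (integer_mod_group h)" for u v
      unfolding mult_integer_mod_group car using h by simp
    show "\<eta> ` carrier (integer_mod_group h) = {semilinear_map D 0 c A | D c A. admissible D c A}"
    proof (intro equalityI subsetI)
      fix f assume "f \<in> \<eta> ` carrier (integer_mod_group h)"
      then obtain a where "f = \<eta> a" by blast
      moreover have "admissible ((w ^ nat a) ^ 2) (N (w ^ nat a)) 0" using w by (intro adm) simp
      ultimately show "f \<in> {semilinear_map D 0 c A | D c A. admissible D c A}"
        unfolding \<eta>_def by blast
    next
      fix f assume "f \<in> {semilinear_map D 0 c A | D c A. admissible D c A}"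
      then obtain D c A where f: "f = semilinear_map D 0 c A" "admissible D c A" by blast
      obtain C s where C: "C \<noteq> 0" "s \<in> {1, -1}" "D = C ^ 2" "c = s * N C" "A = 0"
        by (rule admissible_odd_cases[OF odd(1) f(2)]) (rule that)
      \<comment> \<open>The sign is its own norm, so \<open>s * N C = N (s * C)\<close> and it can
        be absorbed into \<open>C\<close>.\<close>
      have s: "N s = s" "s ^ 2 = 1" "s \<noteq> 0" using C(2) odd odd_characteristic(5)[OF odd(1)] by auto
      have "s * C \<noteq> 0" using s C by simp
      then obtain i where i: "i < h" "s * C = w ^ i" using w(2) by blast
      have "f = \<eta> (int i)"
        using f C s by (simp add: \<eta>_def i(2)[symmetric] norm_mult power_mult_distrib)
      thus "f \<in> \<eta> ` carrier (integer_mod_group h)" using i(1) unfolding car by auto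
    qed
  qed
qed

text \<open>Now \<open>N (-1) = 1\<close>: \<open>C\<close> and \<open>- C\<close> give the same
  map, and the sign cannot be absorbed into \<open>C\<close>. The squares of units and the sign are
  therefore independent and supply the two cyclic factors.\<close>

lemma graph_Aut_odd_even:
  assumes q2: "q > 2" and odd: "odd q" and even: "even (t - 1)"
  shows "\<exists>\<phi> \<in> hom (integer_mod_group m)
      (AutoGroup (integer_mod_group 2 \<times>\<times> integer_mod_group ((q ^ (t - 1) - 1) div 2))).
    G \<cong> semidirect_product (integer_mod_group 2 \<times>\<times> integer_mod_group ((q ^ (t - 1) - 1) div 2))
      (integer_mod_group m) \<phi>"
proof -
  define h where "h = (q ^ (t - 1) - 1) div 2"
  have h2: "q ^ (t - 1) - 1 = 2 * h" using odd by (simp add: h_def)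
  have "q ^ 1 \<le> q ^ (t - 1)" using t q2 by (intro power_increasing) auto
  hence h: "h > 0" using q2 h2 by simp
  let ?H = "integer_mod_group 2 \<times>\<times> integer_mod_group h"
  obtain w :: 'a where w: "w \<noteq> 0" "\<And>x. x \<noteq> 0 \<Longrightarrow> \<exists>i < 2 * h. x = w ^ i" "\<And>i. w ^ i = 1 \<longleftrightarrow> 2 * h dvd i"
    by (rule generator[unfolded h2]) (rule that)
  have "(w ^ h) ^ 2 = 1" using w(3)[of "2 * h"] by (simp add: mult.commute flip: power_mult)
  moreover have "w ^ h \<noteq> 1" using w(3)[of h] h by (auto dest: dvd_imp_le)
  \<comment> \<open>As \<open>w ^ h = -1\<close> has norm 1, shifting the exponent \<open>a\<close>
    by \<open>h\<close> changes neither \<open>(w ^ 2) ^ a\<close> nor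
    \<open>N w ^ a\<close>.\<close>
  ultimately have wh: "w ^ h = -1" by (simp add: power2_eq_1_iff)
  have Nwh: "N w ^ h = 1"
    using odd_characteristic(5)[OF odd] even by (simp add: wh flip: norm_power)
  have w2h: "(w ^ 2) ^ h = 1" using w(3)[of "2 * h"] by (simp flip: power_mult)
  define \<eta> where "\<eta> = (\<lambda>(s, a). semilinear_map ((w ^ 2) ^ nat a) 0 ((-1) ^ nat s * N w ^ nat a) 0)"
  have adm: "admissible ((w ^ 2) ^ i) ((-1) ^ j * N w ^ i) 0" for i j
  proof -
    have "(-1 :: 'a) ^ j \<in> {1, -1}" by (cases "even j") auto
    from admissible_signed_square[OF odd this, of "w ^ i"] w
    show ?thesis by (simp add: norm_power mult.commute flip: power_mult)
  qed
  have car: "carrier ?H = {0..<2} \<times> {0..<int h}"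
    using h by (simp add: DirProd_def carrier_integer_mod_group)
  have mult: "(s, a) \<otimes>\<^bsub>?H\<^esub> (r, b) = ((s + r) mod int 2, (a + b) mod int h)" for s a r b
    by (simp add: DirProd_def)
  show ?thesis unfolding h_def[symmetric]
  proof (rule graph_Aut_semidirect[OF q2])
    show "\<eta> \<in> hom ?H G"
    proof (rule homI)
      fix x show "\<eta> x \<in> carrier G"
        using semilinear_map_automorphism[OF adm] by (cases x) (simp add: \<eta>_def carrier_G)
    next
      fix x y assume xy: "x \<in> carrier ?H" "y \<in> carrier ?H"
      obtain s a r b where [simp]: "x = (s, a)" "y = (r, b)" by (cases x; cases y)
      have nn: "0 \<le> s" "0 \<le> a" "0 \<le> r" "0 \<le> b" using xy unfolding car by auto
      have 1: "(-1 :: 'a) ^ nat ((s + r) mod int 2) = (-1) ^ nat s * (-1) ^ nat r"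
        using nn by (intro power_nat_mod_add) auto
      have 2: "(w ^ 2) ^ nat ((a + b) mod int h) = (w ^ 2) ^ nat a * (w ^ 2) ^ nat b"
        using nn h w2h by (intro power_nat_mod_add) auto
      have 3: "N w ^ nat ((a + b) mod int h) = N w ^ nat a * N w ^ nat b"
        using nn h Nwh by (intro power_nat_mod_add) auto
      have "\<eta> (x \<otimes>\<^bsub>?H\<^esub> y) = semilinear_map ((w ^ 2) ^ nat a * (w ^ 2) ^ nat b) 0
          ((-1) ^ nat s * (-1) ^ nat r * (N w ^ nat a * N w ^ nat b)) 0"
        by (simp only: \<eta>_def mult \<open>x = (s, a)\<close> \<open>y = (r, b)\<close> prod.case 1 2 3)
      also have "\<dots> = \<eta> x \<otimes>\<^bsub>G\<^esub> \<eta> y"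
        by (simp add: \<eta>_def mult_semilinear_maps[OF adm adm] mult_ac)
      finally show "\<eta> (x \<otimes>\<^bsub>?H\<^esub> y) = \<eta> x \<otimes>\<^bsub>G\<^esub> \<eta> y" .
    qed
    show "inj_on \<eta> (carrier ?H)"
    proof (rule inj_onI)
      fix x y assume xy: "x \<in> carrier ?H" "y \<in> carrier ?H" "\<eta> x = \<eta> y"
      obtain s a r b where xy': "x = (s, a)" "y = (r, b)" by (cases x; cases y)
      have b: "s \<in> {0, 1}" "r \<in> {0, 1}" "0 \<le> a" "0 \<le> b" "a < int h" "b < int h"
        using xy unfolding car xy' by auto
      note eq = semilinear_map_eqD(2,3)[OF xy(3)[unfolded xy' \<eta>_def prod.case]]
      have "w ^ (2 * nat a) = w ^ (2 * nat b)" using eq(1) by (simp only: power_mult)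
      hence "2 * nat a = 2 * nat b"
        using b by (intro power_eq_imp_eq_below_order[OF w(3,1)]) auto
      hence "a = b" using b by simp
      hence "(-1 :: 'a) ^ nat s = (-1) ^ nat r" using eq(2) w by simp
      moreover have "(1 :: 'a) \<noteq> -1"
        using odd_characteristic(2)[OF odd] by (metis add.right_inverse one_add_one)
      hence "(-1 :: 'a) \<noteq> 1" by metis
      ultimately have "s = r" using b(1,2) \<open>(1 :: 'a) \<noteq> -1\<close> by auto
      thus "x = y" using \<open>a = b\<close> by (simp add: xy')
    qed
    show "u \<otimes>\<^bsub>?H\<^esub> v \<in> carrier ?H" for u v
    proof -
      obtain s a r b where "u = (s, a)" "v = (r, b)" by (cases u; cases v)
      thus ?thesis using h by (simp only: mult car) simp
    qed
    show "\<eta> ` carrier ?H = {semilinear_map D 0 c A | D c A. admissible D c A}"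
    proof (intro equalityI subsetI)
      fix f assume "f \<in> \<eta> ` carrier ?H"
      then obtain x where "f = \<eta> x" by blast
      moreover obtain s a where "x = (s, a)" by (cases x)
      ultimately show "f \<in> {semilinear_map D 0 c A | D c A. admissible D c A}"
        using adm unfolding \<eta>_def by (simp only: prod.case) blast
    next
      fix f assume "f \<in> {semilinear_map D 0 c A | D c A. admissible D c A}"
      then obtain D c A where f: "f = semilinear_map D 0 c A" "admissible D c A" by blast
      obtain C s where C: "C \<noteq> 0" "s \<in> {1, -1}" "D = C ^ 2" "c = s * N C" "A = 0"
        by (rule admissible_odd_cases[OF odd f(2)]) (rule that)
      obtain i where i: "C = w ^ i" using w(2)[OF C(1)] by blast
      define r where "r = (if s = 1 then 0 else 1 :: int)"
      have s: "s = (-1) ^ nat r" using C(2) by (auto simp: r_def)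
      have "D = (w ^ 2) ^ (i mod h)" "N C = N w ^ (i mod h)"
        unfolding power_mod_eq[OF w2h] power_mod_eq[OF Nwh] by (simp_all add: C(3) i norm_power mult.commute flip: power_mult)
      hence "f = \<eta> (r, int (i mod h))"
        using f C(4,5) s by (simp only: \<eta>_def prod.case nat_int)
      moreover have "(r, int (i mod h)) \<in> carrier ?H" unfolding car using h by (simp add: r_def)
      ultimately show "f \<in> \<eta> ` carrier ?H" by blast
    qed
  qed
qed

text \<open>The cyclic embedding is used twice: the scalings by squares act on the translations, and
  the Frobenius acts on the resulting product. Squaring is bijective here, so a scaling determines
  its \<open>C\<close>, and \<open>C\<close> runs through the whole unit group.\<close>

lemma graph_Aut_even:
  assumes q2: "q > 2" and even: "even q"
  shows "\<exists>\<phi> \<in> hom (integer_mod_group (q ^ (t - 1) - 1))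
      (AutoGroup (product_group {..<m} (\<lambda>_. integer_mod_group p))).
    \<exists>\<psi> \<in> hom (integer_mod_group m)
      (AutoGroup (semidirect_product (product_group {..<m} (\<lambda>_. integer_mod_group p))
        (integer_mod_group (q ^ (t - 1) - 1)) \<phi>)).
      G \<cong> semidirect_product
        (semidirect_product (product_group {..<m} (\<lambda>_. integer_mod_group p))
          (integer_mod_group (q ^ (t - 1) - 1)) \<phi>) (integer_mod_group m) \<psi>"
proof -
  define P where "P = product_group {..<m} (\<lambda>_. integer_mod_group p)"
  define h where "h = q ^ (t - 1) - 1"
  have h: "h > 0" using card_UNIV_ge_2[where ?'a = 'a] by (simp add: h_def card_UNIV)
  have p0: "p > 0" using prime_gt_0_nat[OF prime_p] .
  have grp: "group G" by (rule group_graph_Aut)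
  have carP: "carrier P = (\<Pi>\<^sub>E i\<in>{..<m}. {0..<int p})"
    using p0 by (simp add: P_def carrier_integer_mod_group)
  have multP: "u \<otimes>\<^bsub>P\<^esub> v = (\<lambda>i\<in>{..<m}. (u i + v i) mod int p)" for u v
    by (simp add: P_def)
  have closedP: "u \<otimes>\<^bsub>P\<^esub> v \<in> carrier P" for u v
    unfolding multP carP using p0 by auto
  obtain L :: "(nat \<Rightarrow> int) \<Rightarrow> 'a" where L: "bij_betw L (\<Pi>\<^sub>E i\<in>{..<m}. {0..<int p}) UNIV"
    "\<And>u v. L (\<lambda>i\<in>{..<m}. (u i + v i) mod int p) = L u + L v"
    by (rule prime_field_coordinates[OF prime_char, of m, unfolded CHAR_eq, OF Q_eq]) (rule that)
  obtain w :: 'a where w: "w \<noteq> 0" "\<And>x. x \<noteq> 0 \<Longrightarrow> \<exists>i < h. x = w ^ i" "\<And>i. w ^ i = 1 \<longleftrightarrow> h dvd i"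
    by (rule generator[folded h_def]) (rule that)
  have adm1: "admissible 1 1 A" for A
    using even_characteristic(2)[OF even] by (rule admissible_1)
  have adm: "admissible (C ^ 2) (N C) A" if "C \<noteq> 0" for C A
    using admissible_square_even[OF even that] .
  define \<eta> where "\<eta> u = semilinear_map 1 0 1 (L u)" for u
  define \<sigma> where "\<sigma> = semilinear_map (w ^ 2) 0 (N w) 0"
  have pow: "\<sigma> [^]\<^bsub>G\<^esub> (i :: nat) = semilinear_map ((w ^ i) ^ 2) 0 (N (w ^ i)) 0" for i
    unfolding \<sigma>_def pow_semilinear_map(1)[OF adm[OF w(1)]]
    by (simp only: norm_power power_mult[symmetric] mult.commute)
  have prod: "\<eta> u \<otimes>\<^bsub>G\<^esub> \<sigma> [^]\<^bsub>G\<^esub> (i :: nat) = semilinear_map ((w ^ i) ^ 2) 0 (N (w ^ i)) (L u)" for u i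
  proof -
    have "w ^ i \<noteq> 0" using w by simp
    from mult_semilinear_maps[OF adm1 adm[OF this]] show ?thesis
      unfolding pow \<eta>_def by simp
  qed
  have hom: "\<eta> \<in> hom P G"
  proof (rule homI)
    fix u show "\<eta> u \<in> carrier G"
      using semilinear_map_automorphism[OF adm1] by (simp add: \<eta>_def carrier_G)
  next
    fix u v show "\<eta> (u \<otimes>\<^bsub>P\<^esub> v) = \<eta> u \<otimes>\<^bsub>G\<^esub> \<eta> v"
      unfolding \<eta>_def multP L(2) mult_semilinear_maps[OF adm1 adm1] by (simp add: add.commute)
  qed
  have inj: "inj_on \<eta> (carrier P)"
  proof (rule inj_onI)
    fix u v assume uv: "u \<in> carrier P" "v \<in> carrier P" "\<eta> u = \<eta> v"
    have "L u = L v" using semilinear_map_eqD(1)[OF uv(3)[unfolded \<eta>_def]] .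
    thus "u = v" using L(1) uv(1,2) unfolding carP bij_betw_def by (blast dest: inj_onD)
  qed
  have \<sigma>: "\<sigma> \<in> carrier G"
    using semilinear_map_automorphism[OF adm[OF w(1)]] by (simp add: \<sigma>_def carrier_G)
  have "w ^ h = 1" using w(3)[of h] by simp
  hence \<sigma>h: "\<sigma> [^]\<^bsub>G\<^esub> h = \<one>\<^bsub>G\<^esub>" by (simp add: pow one_G)
  have L_surj: "\<exists>u \<in> carrier P. L u = A" for A
  proof -
    have "A \<in> L ` carrier P" using L(1) unfolding carP bij_betw_def by simp
    thus ?thesis by auto
  qed
  have conj: "\<exists>v\<in>carrier P. \<sigma> \<otimes>\<^bsub>G\<^esub> \<eta> u = \<eta> v \<otimes>\<^bsub>G\<^esub> \<sigma>" for u
  proof -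
    \<comment> \<open>Conjugating a translation by \<open>\<sigma>\<close> multiplies its vector by
      \<open>w ^ 2\<close>.\<close>
    obtain v where v: "v \<in> carrier P" "L v = w ^ 2 * L u" using L_surj by blast
    have "\<sigma> \<otimes>\<^bsub>G\<^esub> \<eta> u = \<eta> v \<otimes>\<^bsub>G\<^esub> \<sigma>"
      unfolding \<eta>_def \<sigma>_def mult_semilinear_maps[OF adm[OF w(1)] adm1] mult_semilinear_maps[OF adm1 adm[OF w(1)]]
      by (simp add: v)
    thus ?thesis using v by blast
  qed
  have uniq: "i = j" if "i < h" "j < h" "\<eta> u \<otimes>\<^bsub>G\<^esub> \<sigma> [^]\<^bsub>G\<^esub> i = \<eta> v \<otimes>\<^bsub>G\<^esub> \<sigma> [^]\<^bsub>G\<^esub> j" for u v i j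
  proof -
    have "(w ^ i) ^ (p ^ 1) = (w ^ j) ^ (p ^ 1)"
      using semilinear_map_eqD(2)[OF that(3)[unfolded prod]] even_characteristic(1)[OF even] by simp
    hence "w ^ i = w ^ j" by (simp only: Frobenius_inj)
    thus ?thesis using that by (intro power_eq_imp_eq_below_order[OF w(3,1)]) auto
  qed
  obtain \<phi> \<Theta> where \<phi>: "\<phi> \<in> hom (integer_mod_group h) (AutoGroup P)"
    and \<Theta>: "\<Theta> \<in> hom (semidirect_product P (integer_mod_group h) \<phi>) G"
      "inj_on \<Theta> (carrier (semidirect_product P (integer_mod_group h) \<phi>))"
      "\<Theta> ` carrier (semidirect_product P (integer_mod_group h) \<phi>) =
        {\<eta> u \<otimes>\<^bsub>G\<^esub> \<sigma> [^]\<^bsub>G\<^esub> i | u i. u \<in> carrier P \<and> i < h}"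
      "\<And>x y. x \<in> carrier (semidirect_product P (integer_mod_group h) \<phi>) \<Longrightarrow>
        y \<in> carrier (semidirect_product P (integer_mod_group h) \<phi>) \<Longrightarrow>
        x \<otimes>\<^bsub>semidirect_product P (integer_mod_group h) \<phi>\<^esub> y
          \<in> carrier (semidirect_product P (integer_mod_group h) \<phi>)"
    by (rule semidirect_product_cyclic_embedding[OF grp h hom inj closedP \<sigma> \<sigma>h conj uniq]) (assumption+, rule that)
  have "{\<eta> u \<otimes>\<^bsub>G\<^esub> \<sigma> [^]\<^bsub>G\<^esub> i | u i. u \<in> carrier P \<and> i < h} =
      {semilinear_map D 0 c A | D c A. admissible D c A}"
  proof (intro equalityI subsetI)
    fix f assume "f \<in> {\<eta> u \<otimes>\<^bsub>G\<^esub> \<sigma> [^]\<^bsub>G\<^esub> i | u i. u \<in> carrier P \<and> i < h}"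
    then obtain u i where "f = semilinear_map ((w ^ i) ^ 2) 0 (N (w ^ i)) (L u)"
      unfolding prod by blast
    moreover have "w ^ i \<noteq> 0" using w by simp
    ultimately show "f \<in> {semilinear_map D 0 c A | D c A. admissible D c A}"
      using adm by blast
  next
    fix f assume "f \<in> {semilinear_map D 0 c A | D c A. admissible D c A}"
    then obtain D c A where f: "f = semilinear_map D 0 c A" "admissible D c A" by blast
    obtain C where C: "C \<noteq> 0" "D = C ^ 2" "c = N C"
      by (rule admissible_even_cases[OF even f(2)]) (rule that)
    obtain i where i: "i < h" "C = w ^ i" using w(2)[OF C(1)] by blast
    obtain u where u: "u \<in> carrier P" "L u = A" using L_surj by blast
    have "f = \<eta> u \<otimes>\<^bsub>G\<^esub> \<sigma> [^]\<^bsub>G\<^esub> i" unfolding prod using f C i u by simp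
    thus "f \<in> {\<eta> u \<otimes>\<^bsub>G\<^esub> \<sigma> [^]\<^bsub>G\<^esub> i | u i. u \<in> carrier P \<and> i < h}"
      using i(1) u(1) by blast
  qed
  \<comment> \<open>The embedding \<open>\<Theta>\<close> of the inner product takes the role of
    \<open>\<eta>\<close> for the outer one.\<close>
  from graph_Aut_semidirect[OF q2 \<Theta>(1,2,4) \<Theta>(3)[unfolded this]]
  show ?thesis unfolding P_def[symmetric] h_def[symmetric] using \<phi> by blast
qed

end

theorem mainTheorem6:
  fixes p k q t :: nat and K :: "'a::{field, finite} set"
  assumes "Factorial_Ring.prime p" and "k \<ge> 1" and "q = p ^ k" and "t \<ge> 2"
    and "card (UNIV :: 'a set) = q ^ (t - 1)"
    and "subfield K (ring_of_type_algebra :: 'a ring)" and "card K = q"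
  shows
    "(odd q \<longrightarrow>
        (\<forall>C. \<forall>i\<in>{1..k * (t - 1)}. \<forall>s\<in>{1, -1}. C \<noteq> 0 \<longrightarrow>
          NG_map_odd p q t K C i s \<in> graph_automorphisms (NG_verts K) (NG_adj q t))) \<and>
     (q = 2 ^ k \<longrightarrow>
        (\<forall>C A. \<forall>i\<in>{1..k * (t - 1)}. C \<noteq> 0 \<longrightarrow>
          NG_map_even p q t K C A i \<in> graph_automorphisms (NG_verts K) (NG_adj q t))) \<and>
     (q > 2 \<longrightarrow>
        (odd q \<longrightarrow>
          graph_automorphisms (NG_verts K) (NG_adj q t) =
            {NG_map_odd p q t K C i s | C i s.
              C \<noteq> 0 \<and> i \<in> {1..k * (t - 1)} \<and> s \<in> {1, -1}}) \<and>
        (even q \<longrightarrow>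
          graph_automorphisms (NG_verts K) (NG_adj q t) =
            {NG_map_even p q t K C A i | C A i. C \<noteq> 0 \<and> i \<in> {1..k * (t - 1)}}) \<and>
        (odd q \<and> odd (t - 1) \<longrightarrow>
          (\<exists>\<phi> \<in> hom (integer_mod_group (k * (t - 1)))
                   (AutoGroup (integer_mod_group (q ^ (t - 1) - 1))).
            graph_Aut (NG_verts K) (NG_adj q t) \<cong>
              semidirect_product (integer_mod_group (q ^ (t - 1) - 1))
                (integer_mod_group (k * (t - 1))) \<phi>)) \<and>
        (odd q \<and> even (t - 1) \<longrightarrow>
          (\<exists>\<phi> \<in> hom (integer_mod_group (k * (t - 1)))
                   (AutoGroup (integer_mod_group 2 \<times>\<times>
                      integer_mod_group ((q ^ (t - 1) - 1) div 2))).
            graph_Aut (NG_verts K) (NG_adj q t) \<cong>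
              semidirect_product
                (integer_mod_group 2 \<times>\<times> integer_mod_group ((q ^ (t - 1) - 1) div 2))
                (integer_mod_group (k * (t - 1))) \<phi>)) \<and>
        (even q \<longrightarrow>
          (\<exists>\<phi> \<in> hom (integer_mod_group (q ^ (t - 1) - 1))
                   (AutoGroup (product_group {..<k * (t - 1)} (\<lambda>_. integer_mod_group p))).
           \<exists>\<psi> \<in> hom (integer_mod_group (k * (t - 1)))
                   (AutoGroup (semidirect_product
                      (product_group {..<k * (t - 1)} (\<lambda>_. integer_mod_group p))
                      (integer_mod_group (q ^ (t - 1) - 1)) \<phi>)).
            graph_Aut (NG_verts K) (NG_adj q t) \<cong>
              semidirect_product
                (semidirect_product
                  (product_group {..<k * (t - 1)} (\<lambda>_. integer_mod_group p))
                  (integer_mod_group (q ^ (t - 1) - 1)) \<phi>)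
                (integer_mod_group (k * (t - 1))) \<psi>)))"
proof -
  interpret projective_norm_graph p k q t K
    using assms by (rule projective_norm_graph.intro)
  have "even q" if "q = 2 ^ k"
    using that assms(2) by simp
  thus ?thesis
    by (intro conjI impI allI ballI NG_map_odd_automorphism NG_map_even_automorphism
        automorphisms_odd automorphisms_even graph_Aut_odd_odd graph_Aut_odd_even graph_Aut_even)
      simp_all
qed

end
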